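(* For any $\lambda\ge0$, any nonnegative weights $w_1,w_2$, and any $\mu,\nu\in{\mathcal M}({\mathcal T})$, $$\mathrm{ET}_{c,\lambda}(\mu,\nu)=\sup_{(u,v)\in\mathbb{K}}\Big[\int_{\mathcal T} u(x)\,\mu(dx)+\int_{\mathcal T} v(x)\,\nu(dx)\Big],$$ where $\mathbb{K}$ is the set of pairs of functions $u\in L^1(\mu)$, $v\in L^1(\nu)$ on ${\mathcal T}$ such that $u\le w_1$, $-b\lambda+\inf_{x\in{\mathcal T}}[b\,c(x,y)-w_1(x)]\le v(y)\le w_2(y)$ for all $y\in{\mathcal T}$, and $u(x)+v(y)\le b[c(x,y)-\lambda]$ for all $x,y\in{\mathcal T}$.
   Context: Let ${\mathcal T}$ be a tree (identified with the set of its nodes and all points on its edges), ${\mathcal M}({\mathcal T})$ the set of nonnegative Borel measures on ${\mathcal T}$ with finite mass. Fix $b\ge0$, a continuous cost $c:{\mathcal T}\times{\mathcal T}\to\mathbb{R}$ with $c(x,x)=0$, and weights $w_1,w_2:{\mathcal T}\to[0,\infty)$. For $\mu,\nu\in{\mathcal M}({\mathcal T})$, $\Pi_{\le}(\mu,\nu)$ is the set of nonnegative finite Borel measures $\gamma$ on ${\mathcal T}\times{\mathcal T}$ with marginals $\gamma_1\le\mu$, $\gamma_2\le\nu$, and $\gamma_1=f_1\mu$, $\gamma_2=f_2\nu$. Define $\mathrm{ET}_{c,\lambda}(\mu,\nu):=\inf_{\gamma\in\Pi_\le(\mu,\nu)}\Big[\int_{\mathcal T} w_1[1-f_1]\,d\mu+\int_{\mathcal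 T} w_2[1-f_2]\,d\nu+b\int_{{\mathcal T}\times{\mathcal T}}[c(x,y)-\lambda]\,\gamma(dx,dy)\Big]$. *)

theory Defs
  imports "HOL-Probability.Probability"
begin

text \<open>A (finite) tree, realised geometrically: a finite union of straight line segments
  in a Euclidean space which is connected and simply connected (no cycles).
  Single-point trees are allowed (degenerate segment).\<close>
definition finite_tree :: "'a::euclidean_space set \<Rightarrow> bool" where
  "finite_tree T \<longleftrightarrow>
     (\<exists>S. finite S \<and> S \<noteq> {} \<and> T = (\<Union>(a,b)\<in>S. closed_segment a b)
        \<and> connected T \<and> simply_connected T)"

definition tree_measures :: "'a::euclidean_space set \<Rightarrow> 'a measure set" where
  "tree_measures T = {\<mu>. sets \<mu> = sets (restrict_space borel T) \<and> emeasure \<mu> T < \<infinity>}"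

definition partial_plans ::
  "'a::euclidean_space set \<Rightarrow> 'a measure \<Rightarrow> 'a measure
     \<Rightarrow> (('a \<times> 'a) measure \<times> ('a \<Rightarrow> real) \<times> ('a \<Rightarrow> real)) set" where
  "partial_plans T \<mu> \<nu> =
    {(\<gamma>, f1, f2).
       sets \<gamma> = sets (restrict_space borel (T \<times> T)) \<and> emeasure \<gamma> (T \<times> T) < \<infinity> \<and>
       f1 \<in> borel_measurable \<mu> \<and> f2 \<in> borel_measurable \<nu> \<and>
       (\<forall>x\<in>T. 0 \<le> f1 x) \<and> (\<forall>x\<in>T. 0 \<le> f2 x) \<and>
       (\<forall>A\<in>sets \<mu>. emeasure (distr \<gamma> (restrict_space borel T) fst) A \<le> emeasure \<mu> A) \<and>
       (\<forall>A\<in>sets \<nu>. emeasure (distr \<gamma> (restrict_space borel T) snd) A \<le> emeasure \<nu> A) \<and>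
       distr \<gamma> (restrict_space borel T) fst = density \<mu> (\<lambda>x. ennreal (f1 x)) \<and>
       distr \<gamma> (restrict_space borel T) snd = density \<nu> (\<lambda>x. ennreal (f2 x))}"

text \<open>The primal objective (extended-real valued, the weight terms may be infinite).\<close>
definition ET_objective ::
  "real \<Rightarrow> ('a \<Rightarrow> 'a \<Rightarrow> real) \<Rightarrow> ('a \<Rightarrow> real) \<Rightarrow> ('a \<Rightarrow> real) \<Rightarrow> real
     \<Rightarrow> 'a measure \<Rightarrow> 'a measure
     \<Rightarrow> (('a \<times> 'a) measure \<times> ('a \<Rightarrow> real) \<times> ('a \<Rightarrow> real)) \<Rightarrow> ereal" where
  "ET_objective b c w1 w2 lam \<mu> \<nu> p =
     (case p of (\<gamma>, f1, f2) \<Rightarrow>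
        enn2ereal (\<integral>\<^sup>+ x. ennreal (w1 x * (1 - f1 x)) \<partial>\<mu>)
      + enn2ereal (\<integral>\<^sup>+ x. ennreal (w2 x * (1 - f2 x)) \<partial>\<nu>)
      + ereal (b * (\<integral> z. (c (fst z) (snd z) - lam) \<partial>\<gamma>)))"

definition ET ::
  "'a::euclidean_space set \<Rightarrow> real \<Rightarrow> ('a \<Rightarrow> 'a \<Rightarrow> real) \<Rightarrow> ('a \<Rightarrow> real) \<Rightarrow> ('a \<Rightarrow> real)
     \<Rightarrow> real \<Rightarrow> 'a measure \<Rightarrow> 'a measure \<Rightarrow> ereal" where
  "ET T b c w1 w2 lam \<mu> \<nu> =
     (INF p \<in> partial_plans T \<mu> \<nu>. ET_objective b c w1 w2 lam \<mu> \<nu> p)"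

definition dual_set ::
  "'a set \<Rightarrow> real \<Rightarrow> ('a \<Rightarrow> 'a \<Rightarrow> real) \<Rightarrow> ('a \<Rightarrow> real) \<Rightarrow> ('a \<Rightarrow> real)
     \<Rightarrow> real \<Rightarrow> 'a measure \<Rightarrow> 'a measure \<Rightarrow> (('a \<Rightarrow> real) \<times> ('a \<Rightarrow> real)) set" where
  "dual_set T b c w1 w2 lam \<mu> \<nu> =
    {(u, v). integrable \<mu> u \<and> integrable \<nu> v \<and>
       (\<forall>x\<in>T. u x \<le> w1 x) \<and>
       (\<forall>y\<in>T. ereal (- b * lam) + (INF x\<in>T. ereal (b * c x y - w1 x)) \<le> ereal (v y)
               \<and> v y \<le> w2 y) \<and>
       (\<forall>x\<in>T. \<forall>y\<in>T. u x + v y \<le> b * (c x y - lam))}"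

end

theory Submission
  imports Defs
begin

text \<open>
  Weak duality is integration of the dual constraints against a plan. For the converse, partition
  \<open>T\<close> into countably many Borel pieces on which position, \<open>w1\<close> and \<open>w2\<close> vary by less than a small
  amount, so that the problem becomes a partial transport problem on \<open>\<nat>\<close>, up to a small error. There
  strong duality is obtained from finite linear programs: the masses with index \<open>\<ge> n\<close> are lumped into
  a single point with weight and cost \<open>0\<close>, which keeps every dual solution of the finite program
  feasible for the full problem; Fourier-Motzkin elimination solves the finite program, and a
  coordinatewise limit of the solutions is an optimal plan, because row and column sums converge by
  dominated convergence and the costs are lower semicontinuous by Fatou. This works for unbounded,
  non-integrable weights. A discrete dual solution \<open>u\<close> is turned into an element of the dual set by
  taking for \<open>v\<close> the minimum of \<open>w2\<close> and the \<open>c\<close>-transform of \<open>u\<close>.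
\<close>

section \<open>Linear programming duality for finite partial transport\<close>

text \<open>A pair \<open>(a, r)\<close> stands for the constraint that the sum of
  \<open>a v * x v\<close> is at most \<open>r\<close>. The cone collects the constraints derivable
  from \<open>C\<close> by nonnegative combinations, so the multipliers of Farkas' lemma are carried
  by the derivation instead of being stored as a vector.\<close>

inductive_set constraint_cone :: "(('v \<Rightarrow> real) \<times> real) set \<Rightarrow> (('v \<Rightarrow> real) \<times> real) set"
  for C where
  base: "p \<in> C \<Longrightarrow> p \<in> constraint_cone C"
| comb: "(a, r) \<in> constraint_cone C \<Longrightarrow> (a', r') \<in> constraint_cone C \<Longrightarrow> 0 \<le> s \<Longrightarrow> 0 \<le> t \<Longrightarrow>
    (\<lambda>v. s * a v + t * a' v, s * r + t * r') \<in> constraint_cone C"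

lemma constraint_cone_subset:
  assumes "C' \<subseteq> constraint_cone C"
  shows "constraint_cone C' \<subseteq> constraint_cone C"
proof
  fix p assume "p \<in> constraint_cone C'"
  then show "p \<in> constraint_cone C"
    by induction (use assms in \<open>auto intro: constraint_cone.comb\<close>)
qed

lemma separate_finite_sets:
  fixes A B :: "real set"
  assumes "finite A" "finite B" "\<And>a b. a \<in> A \<Longrightarrow> b \<in> B \<Longrightarrow> a \<le> b"
  obtains t where "\<And>a. a \<in> A \<Longrightarrow> a \<le> t" "\<And>b. b \<in> B \<Longrightarrow> t \<le> b"
proof (cases "A = {}")
  case True
  \<comment> \<open>When \<open>B\<close> is empty as well, \<open>Min B\<close> is an unspecified
    number and both requirements hold vacuously.\<close>
  then show ?thesis using that[of "Min B"] assms(2) Min_le by blast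
next
  case False
  then show ?thesis using that[of "Max A"] assms by auto
qed

text \<open>The nontrivial direction of Farkas' lemma: if no derivable constraint reads
  \<open>0 \<le> r\<close> with \<open>r\<close> negative, the system has a solution. Variables are
  removed one at a time; without variables each constraint is already of that form, and a solution
  is rebuilt by choosing the removed variable between its lower and upper bounds.\<close>

lemma fourier_motzkin:
  fixes C :: "(('v \<Rightarrow> real) \<times> real) set"
  assumes "finite V" "finite C"
    and "\<And>a r. (a, r) \<in> constraint_cone C \<Longrightarrow> \<forall>v\<in>V. a v = 0 \<Longrightarrow> 0 \<le> r"
  shows "\<exists>x. \<forall>p\<in>C. (\<Sum>v\<in>V. fst p v * x v) \<le> snd p"
  using assms
proof (induction V arbitrary: C rule: finite_induct)
  case empty
  have "0 \<le> snd p" if "p \<in> C" for p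
    using empty.prems(2)[of "fst p" "snd p"] that by (auto intro: constraint_cone.base)
  then show ?case by simp
next
  case (insert w V)
  define pos where "pos = {p \<in> C. fst p w > 0}"
  define neg where "neg = {p \<in> C. fst p w < 0}"
  define zer where "zer = {p \<in> C. fst p w = 0}"
  define elim :: "(('v \<Rightarrow> real) \<times> real) \<times> (('v \<Rightarrow> real) \<times> real) \<Rightarrow> ('v \<Rightarrow> real) \<times> real"
    where "elim = (\<lambda>(p, q). (\<lambda>v. (- fst q w) * fst p v + fst p w * fst q v,
                             (- fst q w) * snd p + fst p w * snd q))"
  \<comment> \<open>Constraints not involving \<open>w\<close> are kept. A constraint bounding
    \<open>w\<close> from above and one bounding it from below are combined with weights that cancel
    the coefficient of \<open>w\<close>.\<close>
  define C' where "C' = zer \<union> elim ` (pos \<times> neg)"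
  have fin: "finite pos" "finite neg" "finite C'"
    using insert.prems(1) by (auto simp: pos_def neg_def zer_def C'_def)
  have sub: "C' \<subseteq> constraint_cone C"
  proof -
    have "elim (p, q) \<in> constraint_cone C" if "p \<in> pos" "q \<in> neg" for p q
      unfolding elim_def split
      using that by (intro constraint_cone.comb)
        (auto simp: pos_def neg_def intro: constraint_cone.base)
    then show ?thesis by (auto simp: C'_def zer_def intro: constraint_cone.base)
  qed
  \<comment> \<open>A constraint derived from \<open>C'\<close> that vanishes on \<open>V\<close>
    therefore vanishes on \<open>insert w V\<close>, which lets the hypothesis on \<open>C\<close>
    pass to \<open>C'\<close>.\<close>
  have w0: "fst p w = 0" if "p \<in> constraint_cone C'" for p
    using that by induction (auto simp: C'_def zer_def elim_def)
  have "\<exists>x. \<forall>p\<in>C'. (\<Sum>v\<in>V. fst p v * x v) \<le> snd p"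
  proof (rule insert.IH[OF fin(3)])
    fix a r assume ar: "(a, r) \<in> constraint_cone C'" "\<forall>v\<in>V. a v = 0"
    then show "0 \<le> r"
      using insert.prems(2)[of a r] w0[OF ar(1)] constraint_cone_subset[OF sub] by auto
  qed
  then obtain x where x: "\<And>p. p \<in> C' \<Longrightarrow> (\<Sum>v\<in>V. fst p v * x v) \<le> snd p" by blast
  \<comment> \<open>\<open>R p\<close> is the slack that the solution for \<open>V\<close> leaves to
    the term in \<open>w\<close>: dividing it by the coefficient of \<open>w\<close> gives an upper
    bound on \<open>w\<close> for \<open>p \<in> pos\<close> and a lower bound for
    \<open>p \<in> neg\<close>.\<close>
  define R where "R p = snd p - (\<Sum>v\<in>V. fst p v * x v)" for p
  have cross: "R q / fst q w \<le> R p / fst p w" if p: "p \<in> pos" and q: "q \<in> neg" for p q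
  proof -
    have "0 \<le> snd (elim (p, q)) - (\<Sum>v\<in>V. fst (elim (p, q)) v * x v)"
      using x[of "elim (p, q)"] that by (auto simp: C'_def)
    also have "\<dots> = (- fst q w) * R p + fst p w * R q"
      by (simp add: elim_def R_def algebra_simps sum.distrib sum_distrib_left sum_subtractf
            sum_negf)
    finally show ?thesis using p q by (auto simp: pos_def neg_def field_simps)
  qed
  obtain t where t: "\<And>q. q \<in> neg \<Longrightarrow> R q / fst q w \<le> t" "\<And>p. p \<in> pos \<Longrightarrow> t \<le> R p / fst p w"
    using separate_finite_sets[of "(\<lambda>q. R q / fst q w) ` neg" "(\<lambda>p. R p / fst p w) ` pos"]
      fin cross by (smt (verit) finite_imageI imageE image_eqI)
  have "(\<Sum>v\<in>insert w V. fst p v * (x(w := t)) v) \<le> snd p" if p: "p \<in> C" for p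
  proof -
    have "(\<Sum>v\<in>insert w V. fst p v * (x(w := t)) v) = fst p w * t + (\<Sum>v\<in>V. fst p v * x v)"
      using insert.hyps by (auto intro!: sum.cong)
    moreover have "fst p w * t \<le> R p"
    proof -
      consider "p \<in> pos" | "p \<in> neg" | "p \<in> zer"
        using p less_linear[of "fst p w" 0] by (auto simp: pos_def neg_def zer_def)
      then show ?thesis
      proof cases
        case 1 then show ?thesis using t(2)[OF 1] by (auto simp: pos_def field_simps)
      next
        case 2 then show ?thesis using t(1)[OF 2] by (auto simp: neg_def field_simps)
      next
        case 3 then show ?thesis using x[of p] by (auto simp: C'_def zer_def R_def)
      qed
    qed
    ultimately show ?thesis by (simp add: R_def)
  qed
  then show ?case by blast
qed

section \<open>Duality for the finite program\<close>

text \<open>The requirement that the objective be at most \<open>D\<close> is taken as one more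
  linear constraint beside the marginal bounds and nonnegativity. A contradiction derived from this
  system would yield, after scaling by the multiplier of the cost constraint, a dual pair of value
  above \<open>D\<close>.\<close>

lemma finite_partial_transport_duality:
  fixes m k W1 W2 :: "nat \<Rightarrow> real" and K :: "nat \<Rightarrow> nat \<Rightarrow> real"
  assumes m: "\<And>i. 0 \<le> m i" and k: "\<And>j. 0 \<le> k j"
    and dual: "\<And>u v. (\<And>i. i \<le> n \<Longrightarrow> u i \<le> W1 i) \<Longrightarrow> (\<And>j. j \<le> n \<Longrightarrow> v j \<le> W2 j) \<Longrightarrow>
      (\<And>i j. i \<le> n \<Longrightarrow> j \<le> n \<Longrightarrow> u i + v j \<le> K i j) \<Longrightarrow>
      (\<Sum>i\<le>n. u i * m i) + (\<Sum>j\<le>n. v j * k j) \<le> D"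
  obtains g :: "nat \<Rightarrow> nat \<Rightarrow> real" where
    "\<And>i j. i \<le> n \<Longrightarrow> j \<le> n \<Longrightarrow> 0 \<le> g i j"
    "\<And>i. i \<le> n \<Longrightarrow> (\<Sum>j\<le>n. g i j) \<le> m i"
    "\<And>j. j \<le> n \<Longrightarrow> (\<Sum>i\<le>n. g i j) \<le> k j"
    "(\<Sum>i\<le>n. W1 i * (m i - (\<Sum>j\<le>n. g i j))) + (\<Sum>j\<le>n. W2 j * (k j - (\<Sum>i\<le>n. g i j)))
      + (\<Sum>i\<le>n. \<Sum>j\<le>n. K i j * g i j) \<le> D"
proof -
  define V where "V = {..n} \<times> {..n}"
  \<comment> \<open>The objective is the sum of \<open>red (i, j) * g i j\<close> plus the cost of
    leaving all mass in place; \<open>bal\<close> is what remains of \<open>D\<close> after that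
    constant. Thus \<open>red\<close> is the change in cost when a unit is moved from
    \<open>i\<close> to \<open>j\<close>.\<close>
  define bal where "bal = D - (\<Sum>i\<le>n. W1 i * m i) - (\<Sum>j\<le>n. W2 j * k j)"
  define red where "red = (\<lambda>(i, j). K i j - W1 i - W2 j)"
  define row where "row i = ((\<lambda>(i', j). of_bool (i' = i)) :: nat \<times> nat \<Rightarrow> real, m i)" for i
  define col where "col j = ((\<lambda>(i, j'). of_bool (j' = j)) :: nat \<times> nat \<Rightarrow> real, k j)" for j
  define neg_entry where "neg_entry e = ((\<lambda>e'. - of_bool (e' = e)) :: nat \<times> nat \<Rightarrow> real, 0 :: real)" for e
  define C where "C = insert (red, bal) (row ` {..n} \<union> col ` {..n} \<union> neg_entry ` V)"
  have fin: "finite V" "finite C" by (auto simp: V_def C_def)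
  \<comment> \<open>Here \<open>y\<close> is the multiplier of the cost constraint and
    \<open>\<alpha>\<close>, \<open>\<beta>\<close> are those of the rows and columns. The
    multipliers of \<open>neg_entry\<close> only lower the left-hand coefficients, hence an
    inequality in the first component and an equality in the second.\<close>
  have inv: "\<exists>y \<alpha> \<beta>. 0 \<le> y \<and> (\<forall>i\<le>n. 0 \<le> \<alpha> i) \<and> (\<forall>j\<le>n. 0 \<le> \<beta> j) \<and>
      (\<forall>i\<le>n. \<forall>j\<le>n. fst p (i, j) \<le> y * red (i, j) + \<alpha> i + \<beta> j) \<and>
      snd p = y * bal + (\<Sum>i\<le>n. \<alpha> i * m i) + (\<Sum>j\<le>n. \<beta> j * k j)"
    if "p \<in> constraint_cone C" for p
    using that
  proof induction
    case (base p)
    then consider "p = (red, bal)" | i where "i \<le> n" "p = row i" | j where "j \<le> n" "p = col j"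
      | e where "p = neg_entry e"
      by (auto simp: C_def)
    then show ?case
    proof cases
      case 1
      then show ?thesis
        by (intro exI[of _ 1] exI[of _ "\<lambda>_. 0"]) simp
    next
      case 2
      then show ?thesis
        by (intro exI[of _ 0] exI[of _ "\<lambda>i'. of_bool (i' = i)"] exI[of _ "\<lambda>_. 0"])
           (auto simp: row_def of_bool_def if_distrib[of "\<lambda>x. x * _"] cong: if_cong)
    next
      case 3
      then show ?thesis
        by (intro exI[of _ 0] exI[of _ "\<lambda>_. 0"] exI[of _ "\<lambda>j'. of_bool (j' = j)"])
           (auto simp: col_def of_bool_def if_distrib[of "\<lambda>x. x * _"] cong: if_cong)
    next
      case 4
      then show ?thesis
        by (intro exI[of _ 0] exI[of _ "\<lambda>_. 0"]) (simp add: neg_entry_def)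
    qed
  next
    case (comb a r a' r' s t)
    obtain y \<alpha> \<beta> where 1: "0 \<le> y" "\<And>i. i \<le> n \<Longrightarrow> 0 \<le> \<alpha> i" "\<And>j. j \<le> n \<Longrightarrow> 0 \<le> \<beta> j"
      "\<And>i j. i \<le> n \<Longrightarrow> j \<le> n \<Longrightarrow> a (i, j) \<le> y * red (i, j) + \<alpha> i + \<beta> j"
      "r = y * bal + (\<Sum>i\<le>n. \<alpha> i * m i) + (\<Sum>j\<le>n. \<beta> j * k j)"
      using comb.IH(1) unfolding fst_conv snd_conv by blast
    obtain y' \<alpha>' \<beta>' where 2: "0 \<le> y'" "\<And>i. i \<le> n \<Longrightarrow> 0 \<le> \<alpha>' i"
      "\<And>j. j \<le> n \<Longrightarrow> 0 \<le> \<beta>' j"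
      "\<And>i j. i \<le> n \<Longrightarrow> j \<le> n \<Longrightarrow> a' (i, j) \<le> y' * red (i, j) + \<alpha>' i + \<beta>' j"
      "r' = y' * bal + (\<Sum>i\<le>n. \<alpha>' i * m i) + (\<Sum>j\<le>n. \<beta>' j * k j)"
      using comb.IH(2) unfolding fst_conv snd_conv by blast
    have le: "s * a (i, j) + t * a' (i, j)
        \<le> (s * y + t * y') * red (i, j) + (s * \<alpha> i + t * \<alpha>' i) + (s * \<beta> j + t * \<beta>' j)"
      if "i \<le> n" "j \<le> n" for i j
      using mult_left_mono[OF 1(4)[OF that] comb.hyps(3)]
        mult_left_mono[OF 2(4)[OF that] comb.hyps(4)]
      by (simp add: algebra_simps)
    have eq: "s * r + t * r' = (s * y + t * y') * bal + (\<Sum>i\<le>n. (s * \<alpha> i + t * \<alpha>' i) * m i)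
        + (\<Sum>j\<le>n. (s * \<beta> j + t * \<beta>' j) * k j)"
      by (simp add: 1(5) 2(5) algebra_simps sum.distrib sum_distrib_left)
    show ?case
      using le eq comb.hyps 1(1-3) 2(1-3)
      by (intro exI[of _ "s * y + t * y'"] exI[of _ "\<lambda>i. s * \<alpha> i + t * \<alpha>' i"]
            exI[of _ "\<lambda>j. s * \<beta> j + t * \<beta>' j"]) simp
  qed
  have nonneg: "0 \<le> r" if ar: "(a, r) \<in> constraint_cone C" "\<forall>v\<in>V. a v = 0" for a r
  proof -
    obtain y \<alpha> \<beta> where y: "0 \<le> y" and \<alpha>: "\<And>i. i \<le> n \<Longrightarrow> 0 \<le> \<alpha> i"
      and \<beta>: "\<And>j. j \<le> n \<Longrightarrow> 0 \<le> \<beta> j"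
      and le: "\<And>i j. i \<le> n \<Longrightarrow> j \<le> n \<Longrightarrow> a (i, j) \<le> y * red (i, j) + \<alpha> i + \<beta> j"
      and r: "r = y * bal + (\<Sum>i\<le>n. \<alpha> i * m i) + (\<Sum>j\<le>n. \<beta> j * k j)"
      using inv[OF ar(1)] unfolding fst_conv snd_conv by blast
    have le0: "0 \<le> y * red (i, j) + \<alpha> i + \<beta> j" if "i \<le> n" "j \<le> n" for i j
      using le[OF that] ar(2) that by (auto simp: V_def)
    show "0 \<le> r"
    proof (cases "y = 0")
      case True
      then show ?thesis unfolding r using \<alpha> \<beta> m k by (auto intro!: sum_nonneg add_nonneg_nonneg)
    next
      case False
      with y have y: "0 < y" by simp
      \<comment> \<open>The row and column multipliers, normalised by \<open>y\<close>, are the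
        amounts by which the dual variables stay below the weights. With this choice
        \<open>r\<close> is \<open>y\<close> times the gap between \<open>D\<close> and the dual
        value.\<close>
      define u where "u i = W1 i - \<alpha> i / y" for i
      define v where "v j = W2 j - \<beta> j / y" for j
      have "(\<Sum>i\<le>n. u i * m i) + (\<Sum>j\<le>n. v j * k j) \<le> D"
      proof (rule dual)
        fix i j assume "i \<le> n" "j \<le> n"
        then show "u i + v j \<le> K i j"
          using divide_nonneg_pos[OF le0[of i j] y] y
          by (simp add: u_def v_def red_def add_divide_distrib)
      qed (use \<alpha> \<beta> y in \<open>auto simp: u_def v_def\<close>)
      then have "0 \<le> y * (D - (\<Sum>i\<le>n. u i * m i) - (\<Sum>j\<le>n. v j * k j))"
        using y by simp
      also have "\<dots> = r"
        using y by (simp add: r bal_def u_def v_def algebra_simps sum_subtractf sum_distrib_left)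
      finally show ?thesis .
    qed
  qed
  obtain x where x: "\<And>p. p \<in> C \<Longrightarrow> (\<Sum>e\<in>V. fst p e * x e) \<le> snd p"
    using fourier_motzkin[OF fin] nonneg by metis
  define g where "g i j = x (i, j)" for i j
  have sumV: "(\<Sum>e\<in>V. f e * x e) = (\<Sum>i\<le>n. \<Sum>j\<le>n. f (i, j) * g i j)" for f
    by (simp add: V_def sum.cartesian_product g_def case_prod_beta)
  show ?thesis
  proof (rule that[of g])
    fix i j assume ij: "i \<le> n" "j \<le> n"
    then have "(\<Sum>e\<in>V. fst (neg_entry (i, j)) e * x e) \<le> snd (neg_entry (i, j))"
      by (intro x) (auto simp: C_def V_def)
    moreover have "(\<Sum>e\<in>V. fst (neg_entry (i, j)) e * x e) = (\<Sum>e\<in>V. if e = (i, j) then - x e else 0)"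
      by (intro sum.cong) (auto simp: neg_entry_def)
    ultimately show "0 \<le> g i j" using ij fin(1)
      by (simp add: neg_entry_def g_def V_def)
  next
    fix i assume i: "i \<le> n"
    then have "(\<Sum>e\<in>V. fst (row i) e * x e) \<le> snd (row i)" by (intro x) (auto simp: C_def)
    moreover have "(\<Sum>e\<in>V. fst (row i) e * x e) = (\<Sum>i'\<le>n. if i' = i then \<Sum>j\<le>n. g i j else 0)"
      unfolding sumV by (intro sum.cong) (auto simp: row_def)
    ultimately show "(\<Sum>j\<le>n. g i j) \<le> m i" using i by (simp add: row_def)
  next
    fix j assume j: "j \<le> n"
    then have "(\<Sum>e\<in>V. fst (col j) e * x e) \<le> snd (col j)" by (intro x) (auto simp: C_def)
    moreover have "(\<Sum>e\<in>V. fst (col j) e * x e) = (\<Sum>i\<le>n. \<Sum>j'\<le>n. if j' = j then g i j' else 0)"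
      unfolding sumV by (intro sum.cong) (auto simp: col_def)
    ultimately show "(\<Sum>i\<le>n. g i j) \<le> k j" using j by (simp add: col_def)
  next
    have "(\<Sum>e\<in>V. red e * x e) \<le> bal" using x[of "(red, bal)"] by (simp add: C_def)
    moreover have "(\<Sum>e\<in>V. red e * x e) = (\<Sum>i\<le>n. \<Sum>j\<le>n. K i j * g i j)
        - (\<Sum>i\<le>n. \<Sum>j\<le>n. W1 i * g i j) - (\<Sum>i\<le>n. \<Sum>j\<le>n. W2 j * g i j)"
      unfolding sumV by (simp add: red_def algebra_simps sum.distrib sum_subtractf)
    moreover have "(\<Sum>i\<le>n. \<Sum>j\<le>n. W2 j * g i j) = (\<Sum>j\<le>n. \<Sum>i\<le>n. W2 j * g i j)"
      by (rule sum.swap)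
    ultimately show "(\<Sum>i\<le>n. W1 i * (m i - (\<Sum>j\<le>n. g i j)))
        + (\<Sum>j\<le>n. W2 j * (k j - (\<Sum>i\<le>n. g i j))) + (\<Sum>i\<le>n. \<Sum>j\<le>n. K i j * g i j) \<le> D"
      by (simp add: bal_def algebra_simps sum_subtractf sum_distrib_left)
  qed
qed

section \<open>Countable partial transport\<close>

text \<open>By Tychonoff's theorem the box is compact. A countable index set makes the product
  topology first countable, so compactness gives a convergent subsequence, and the coordinates are
  continuous.\<close>

lemma bounded_family_convergent_subsequence:
  fixes G :: "nat \<Rightarrow> 'i::countable \<Rightarrow> real"
  assumes "\<And>n i. G n i \<in> {0..B i}"
  obtains s g where "strict_mono s" "\<And>i. (\<lambda>n. G (s n) i) \<longlonglongrightarrow> g i"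
proof -
  have "compactin (product_topology (\<lambda>_. euclidean) UNIV) (PiE UNIV (\<lambda>i. {0..B i}))"
    by (subst compactin_PiE) auto
  then have "compact (PiE UNIV (\<lambda>i. {0..B i}))"
    by (simp add: euclidean_product_topology)
  then have "seq_compact (PiE UNIV (\<lambda>i. {0..B i}))"
    by (rule compact_imp_seq_compact)
  moreover have "\<forall>n. G n \<in> PiE UNIV (\<lambda>i. {0..B i})" using assms by auto
  ultimately obtain g s where s: "strict_mono s" "(G \<circ> s) \<longlonglongrightarrow> g"
    by (metis seq_compactE)
  have "(\<lambda>n. G (s n) i) \<longlonglongrightarrow> g i" for i
  proof -
    have "continuous_on UNIV (\<lambda>h :: 'i \<Rightarrow> real. h i)" by (rule continuous_on_product_coordinates)
    then have "isCont (\<lambda>h :: 'i \<Rightarrow> real. h i) g" by (metis UNIV_I continuous_on_eq_continuous_at open_UNIV)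
    from isCont_tendsto_compose[OF this s(2)] show ?thesis by (simp add: o_def)
  qed
  with s(1) show ?thesis by (rule that)
qed

text \<open>Tannery's theorem; the limit sequence inherits the majorant \<open>M\<close> and is
  summable for that reason.\<close>

lemma tendsto_suminf_dominated:
  fixes a :: "nat \<Rightarrow> nat \<Rightarrow> real"
  assumes "\<And>j. (\<lambda>n. a n j) \<longlonglongrightarrow> b j" "\<And>n j. \<bar>a n j\<bar> \<le> M j" "summable M"
  shows "summable b" "(\<lambda>n. \<Sum>j. a n j) \<longlonglongrightarrow> (\<Sum>j. b j)"
proof -
  have "\<bar>b j\<bar> \<le> M j" for j
    by (rule tendsto_upperbound[OF tendsto_rabs[OF assms(1)]]) (use assms(2) in auto)
  then show "summable b" by (intro summable_comparison_test'[OF assms(3)]) auto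
  show "(\<lambda>n. \<Sum>j. a n j) \<longlonglongrightarrow> (\<Sum>j. b j)"
    by (rule conjunct2[OF conjunct2[OF tannerys_theorem[where a = "\<lambda>j n. a n j" and M = M]]])
       (use assms in \<open>simp_all add: case_prod_beta'\<close>)
qed

section \<open>Duality on the natural numbers\<close>

text \<open>The dual bound is asked only of pairs with finite range, because the pairs coming from
  the lumped programs take at most \<open>n + 1\<close> values each. This keeps them bounded, so
  their series and later their integrals converge whatever the weights are. The plan is a limit of
  finite plans.\<close>

lemma countable_partial_transport_duality:
  fixes m k W1 W2 :: "nat \<Rightarrow> real" and K :: "nat \<Rightarrow> nat \<Rightarrow> real"
  assumes m: "\<And>i. 0 \<le> m i" "summable m" and k: "\<And>j. 0 \<le> k j" "summable k"
    and W: "\<And>i. 0 \<le> W1 i" "\<And>j. 0 \<le> W2 j" and K: "\<And>i j. 0 \<le> K i j"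
    and dual: "\<And>u v. finite (range u) \<Longrightarrow> finite (range v) \<Longrightarrow> (\<And>i. u i \<le> W1 i) \<Longrightarrow>
      (\<And>j. v j \<le> W2 j) \<Longrightarrow> (\<And>i j. u i + v j \<le> K i j) \<Longrightarrow>
      (\<Sum>i. u i * m i) + (\<Sum>j. v j * k j) \<le> D"
  obtains g :: "nat \<Rightarrow> nat \<Rightarrow> real" where
    "\<And>i j. 0 \<le> g i j" "\<And>i. summable (g i)" "\<And>j. summable (\<lambda>i. g i j)"
    "\<And>i. (\<Sum>j. g i j) \<le> m i" "\<And>j. (\<Sum>i. g i j) \<le> k j"
    "(\<Sum>i. ennreal (W1 i * (m i - (\<Sum>j. g i j)))) + (\<Sum>j. ennreal (W2 j * (k j - (\<Sum>i. g i j))))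
      + (\<Sum>i. \<Sum>j. ennreal (K i j * g i j)) \<le> ennreal D"
proof -
  \<comment> \<open>Only arguments \<open>i \<le> n\<close> are used below, so the second branch
    concerns the single point \<open>n\<close>, which carries the whole tail.\<close>
  define lump where "lump f n i = (if i < n then f i else (\<Sum>l. f (l + n)))"
    for f :: "nat \<Rightarrow> real" and n i
  define cut where "cut f n i = (if i < n then f i else 0)" for f :: "nat \<Rightarrow> real" and n i :: nat
  define cut2 where "cut2 n i j = (if i < n \<and> j < n then K i j else 0)" for n i j :: nat
  have lump_nonneg: "0 \<le> lump f n i" if "\<And>i. 0 \<le> f i" "summable f" for f n i
    using that by (auto simp: lump_def intro!: suminf_nonneg summable_ignore_initial_segment)
  \<comment> \<open>Pairing \<open>u\<close> with the lumped masses is the same as pairing its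
    extension \<open>u (min i n)\<close> with the original ones; this carries the dual value from
    the finite program to the full one.\<close>
  have sum_lump: "(\<Sum>i\<le>n. u i * lump f n i) = (\<Sum>i. u (min i n) * f i)"
    if f: "summable f" for u f n
  proof -
    have tail: "(\<lambda>l. u (min (l + n) n) * f (l + n)) = (\<lambda>l. u n * f (l + n))"
      by (simp add: min_absorb2)
    have sf: "summable (\<lambda>l. f (l + n))" by (rule summable_ignore_initial_segment[OF f])
    then have "summable (\<lambda>l. u (min (l + n) n) * f (l + n))"
      unfolding tail by (rule summable_mult)
    then have "summable (\<lambda>i. u (min i n) * f i)" by (rule summable_iff_shift[THEN iffD1])
    from suminf_split_initial_segment[OF this, of n]
    have "(\<Sum>i. u (min i n) * f i) = u n * (\<Sum>l. f (l + n)) + (\<Sum>i<n. u i * f i)"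
      unfolding tail suminf_mult[OF sf] by simp
    then show ?thesis by (simp add: lump_def lessThan_Suc_atMost[symmetric])
  qed
  define plan where "plan n h \<longleftrightarrow> (\<forall>i\<le>n. \<forall>j\<le>n. 0 \<le> h i j)
      \<and> (\<forall>i\<le>n. (\<Sum>j\<le>n. h i j) \<le> lump m n i) \<and> (\<forall>j\<le>n. (\<Sum>i\<le>n. h i j) \<le> lump k n j)
      \<and> (\<Sum>i\<le>n. cut W1 n i * (lump m n i - (\<Sum>j\<le>n. h i j)))
        + (\<Sum>j\<le>n. cut W2 n j * (lump k n j - (\<Sum>i\<le>n. h i j)))
        + (\<Sum>i\<le>n. \<Sum>j\<le>n. cut2 n i j * h i j) \<le> D" for n h
  have "\<exists>h. plan n h" for n
  proof -
    have d: "(\<Sum>i\<le>n. u i * lump m n i) + (\<Sum>j\<le>n. v j * lump k n j) \<le> D"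
      if u: "\<And>i. i \<le> n \<Longrightarrow> u i \<le> cut W1 n i" and v: "\<And>j. j \<le> n \<Longrightarrow> v j \<le> cut W2 n j"
        and uv: "\<And>i j. i \<le> n \<Longrightarrow> j \<le> n \<Longrightarrow> u i + v j \<le> cut2 n i j" for u v
      unfolding sum_lump[OF m(2)] sum_lump[OF k(2)]
    proof (rule dual)
      have "range (\<lambda>i. f (min i n)) \<subseteq> f ` {..n}" for f :: "nat \<Rightarrow> real" by auto
      then show "finite (range (\<lambda>i. u (min i n)))" "finite (range (\<lambda>j. v (min j n)))"
        by (meson finite_atMost finite_imageI finite_subset)+
      show "u (min i n) \<le> W1 i" for i
        \<comment> \<open>For \<open>i \<ge> n\<close> the bound comes from the lumped point, where
          \<open>u n \<le> 0\<close>, and \<open>0 \<le> W1 i\<close>. The other two constraints are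
          treated alike.\<close>
        using u[of "min i n"] W(1)[of i] by (auto simp: cut_def min_def split: if_splits)
      show "v (min j n) \<le> W2 j" for j
        using v[of "min j n"] W(2)[of j] by (auto simp: cut_def min_def split: if_splits)
      show "u (min i n) + v (min j n) \<le> K i j" for i j
        using uv[of "min i n" "min j n"] K[of i j]
        by (auto simp: cut2_def min_def split: if_splits)
    qed
    show ?thesis
      by (rule finite_partial_transport_duality[of "lump m n" "lump k n" n "cut W1 n" "cut W2 n"
            "cut2 n" D]) (use lump_nonneg[OF m] lump_nonneg[OF k] d in \<open>auto simp: plan_def\<close>)
  qed
  then obtain H where "\<And>n. plan n (H n)" by metis
  then have H: "\<And>n i j. i \<le> n \<Longrightarrow> j \<le> n \<Longrightarrow> 0 \<le> H n i j"
      "\<And>n i. i \<le> n \<Longrightarrow> (\<Sum>j\<le>n. H n i j) \<le> lump m n i"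
      "\<And>n j. j \<le> n \<Longrightarrow> (\<Sum>i\<le>n. H n i j) \<le> lump k n j"
      "\<And>n. (\<Sum>i\<le>n. cut W1 n i * (lump m n i - (\<Sum>j\<le>n. H n i j)))
        + (\<Sum>j\<le>n. cut W2 n j * (lump k n j - (\<Sum>i\<le>n. H n i j)))
        + (\<Sum>i\<le>n. \<Sum>j\<le>n. cut2 n i j * H n i j) \<le> D"
    by (simp_all add: plan_def)
  \<comment> \<open>\<open>G n\<close> drops the mass coupled to the lumped point, which vanishes in the limit.\<close>
  define G where "G n i j = (if i < n \<and> j < n then H n i j else 0)" for n i j
  have entry_row: "H n i j \<le> lump m n i" if "i \<le> n" "j \<le> n" for n i j
    using H(2)[OF that(1)] member_le_sum[of j "{..n}" "H n i"] H(1) that by fastforce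
  have entry_col: "H n i j \<le> lump k n j" if "i \<le> n" "j \<le> n" for n i j
    using H(3)[OF that(2)] member_le_sum[of i "{..n}" "\<lambda>i. H n i j"] H(1) that by fastforce
  \<comment> \<open>The bounds by \<open>m i\<close> and \<open>k j\<close> do not depend on
    \<open>n\<close>: they give compactness here and the majorants for row and column sums
    below.\<close>
  have G0: "0 \<le> G n i j" for n i j using H(1) by (simp add: G_def)
  have Gm: "G n i j \<le> m i" for n i j using entry_row[of i n j] m(1) by (auto simp: G_def lump_def)
  have Gk: "G n i j \<le> k j" for n i j using entry_col[of i n j] k(1) by (auto simp: G_def lump_def)
  obtain s g where s: "strict_mono s" and g: "\<And>i j. (\<lambda>n. G (s n) i j) \<longlonglongrightarrow> g i j"
  proof -
    define G' where "G' n e = G n (fst e) (snd e)" for n e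
    have "G' n e \<in> {0..m (fst e)}" for n e
      using G0 Gm by (simp add: G'_def)
    from bounded_family_convergent_subsequence[of G', OF this]
    obtain s g where s: "strict_mono s" "\<And>e. (\<lambda>n. G' (s n) e) \<longlonglongrightarrow> g e"
      by blast
    show ?thesis
    proof (rule that[OF s(1)])
      show "(\<lambda>n. G (s n) i j) \<longlonglongrightarrow> g (i, j)" for i j using s(2)[of "(i, j)"] by (simp add: G'_def)
    qed
  qed
  have s_top: "filterlim s at_top sequentially" by (rule filterlim_subseq[OF s])
  have g0: "0 \<le> g i j" for i j by (rule tendsto_lowerbound[OF g]) (use G0 in auto)
  \<comment> \<open>Within a row the column index varies, so the summable majorant is
    \<open>k\<close>; for columns it is \<open>m\<close>.\<close>
  have row: "summable (g i)" "(\<lambda>n. \<Sum>j. G (s n) i j) \<longlonglongrightarrow> (\<Sum>j. g i j)" for i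
    by (rule tendsto_suminf_dominated[OF g _ k(2)]; use G0 Gk in simp)+
  have col: "summable (\<lambda>i. g i j)" "(\<lambda>n. \<Sum>i. G (s n) i j) \<longlonglongrightarrow> (\<Sum>i. g i j)" for j
    by (rule tendsto_suminf_dominated[OF g _ m(2)]; use G0 Gm in simp)+
  \<comment> \<open>Row sums of \<open>H n\<close> and \<open>G n\<close> differ only by the mass
    sent to the lumped point, which is at most the tail \<open>lump k n n\<close>.\<close>
  have Grow: "(\<Sum>j\<le>n. H n i j) = (\<Sum>j. G n i j) + H n i n" if "i < n" for n i
  proof -
    have "(\<Sum>j. G n i j) = (\<Sum>j<n. G n i j)" by (rule suminf_finite) (auto simp: G_def)
    then show ?thesis using that by (simp add: G_def lessThan_Suc_atMost[symmetric])
  qed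
  have Gcol: "(\<Sum>i\<le>n. H n i j) = (\<Sum>i. G n i j) + H n n j" if "j < n" for n j
  proof -
    have "(\<Sum>i. G n i j) = (\<Sum>i<n. G n i j)" by (rule suminf_finite) (auto simp: G_def)
    then show ?thesis using that by (simp add: G_def lessThan_Suc_atMost[symmetric])
  qed
  have tail0: "(\<lambda>n. lump f (s n) (s n)) \<longlonglongrightarrow> 0" if "summable f" for f
  proof -
    have "(\<lambda>n. \<Sum>l. f (l + n)) \<longlonglongrightarrow> 0" by (rule suminf_exist_split2[OF that])
    from filterlim_compose[OF this s_top] show ?thesis by (simp add: lump_def)
  qed
  have row_le: "(\<Sum>j. g i j) \<le> m i" for i
  proof (rule tendsto_upperbound[OF row(2)])
    have "(\<Sum>j. G n i j) \<le> m i" for n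
    proof (cases "i < n")
      case True
      then show ?thesis using Grow[OF True] H(1)[of i n n] H(2)[of i n] by (simp add: lump_def)
    qed (simp add: G_def m)
    then show "\<forall>\<^sub>F n in sequentially. (\<Sum>j. G (s n) i j) \<le> m i" by simp
  qed simp
  have col_le: "(\<Sum>i. g i j) \<le> k j" for j
  proof (rule tendsto_upperbound[OF col(2)])
    have "(\<Sum>i. G n i j) \<le> k j" for n
    proof (cases "j < n")
      case True
      then show ?thesis using Gcol[OF True] H(1)[of n n j] H(3)[of j n] by (simp add: lump_def)
    qed (simp add: G_def k)
    then show "\<forall>\<^sub>F n in sequentially. (\<Sum>i. G (s n) i j) \<le> k j" by simp
  qed simp
  \<comment> \<open>Truncated sums involve finitely many rows, columns and entries, so the limit may
    be taken termwise; letting the truncation grow afterwards gives the inequality of Fatou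
    type.\<close>
  have part: "(\<Sum>i<N. W1 i * (m i - (\<Sum>j. g i j))) + (\<Sum>j<N. W2 j * (k j - (\<Sum>i. g i j)))
      + (\<Sum>i<N. \<Sum>j<N'. K i j * g i j) \<le> D" for N N'
  proof -
    \<comment> \<open>The tails subtracted here compensate for the mass dropped in \<open>G\<close>,
      so that the expression stays below the finite objective; they vanish in the limit.\<close>
    have lim: "(\<lambda>n. (\<Sum>i<N. W1 i * (m i - (\<Sum>j. G (s n) i j) - lump k (s n) (s n)))
        + (\<Sum>j<N. W2 j * (k j - (\<Sum>i. G (s n) i j) - lump m (s n) (s n)))
        + (\<Sum>i<N. \<Sum>j<N'. K i j * G (s n) i j)) \<longlonglongrightarrow>
      (\<Sum>i<N. W1 i * (m i - (\<Sum>j. g i j) - 0)) + (\<Sum>j<N. W2 j * (k j - (\<Sum>i. g i j) - 0))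
      + (\<Sum>i<N. \<Sum>j<N'. K i j * g i j)"
      by (intro tendsto_intros row col g tail0 m k)
    have "(\<Sum>i<N. W1 i * (m i - (\<Sum>j. G n i j) - lump k n n))
        + (\<Sum>j<N. W2 j * (k j - (\<Sum>i. G n i j) - lump m n n))
        + (\<Sum>i<N. \<Sum>j<N'. K i j * G n i j) \<le> D" if n: "n \<ge> max N N'" for n
    proof -
      have "(\<Sum>i<N. W1 i * (m i - (\<Sum>j. G n i j) - lump k n n))
          \<le> (\<Sum>i<N. cut W1 n i * (lump m n i - (\<Sum>j\<le>n. H n i j)))"
        using n Grow entry_col[of _ n n] W(1)
        by (intro sum_mono) (auto simp: cut_def lump_def intro!: mult_left_mono)
      also have "\<dots> \<le> (\<Sum>i\<le>n. cut W1 n i * (lump m n i - (\<Sum>j\<le>n. H n i j)))"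
        using n H(2) W(1) by (intro sum_mono2) (auto simp: cut_def)
      finally have 1: "(\<Sum>i<N. W1 i * (m i - (\<Sum>j. G n i j) - lump k n n)) \<le> \<dots>" .
      have "(\<Sum>j<N. W2 j * (k j - (\<Sum>i. G n i j) - lump m n n))
          \<le> (\<Sum>j<N. cut W2 n j * (lump k n j - (\<Sum>i\<le>n. H n i j)))"
        using n Gcol entry_row[of n n] W(2)
        by (intro sum_mono) (auto simp: cut_def lump_def intro!: mult_left_mono)
      also have "\<dots> \<le> (\<Sum>j\<le>n. cut W2 n j * (lump k n j - (\<Sum>i\<le>n. H n i j)))"
        using n H(3) W(2) by (intro sum_mono2) (auto simp: cut_def)
      finally have 2: "(\<Sum>j<N. W2 j * (k j - (\<Sum>i. G n i j) - lump m n n)) \<le> \<dots>" .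
      have "(\<Sum>i<N. \<Sum>j<N'. K i j * G n i j) = (\<Sum>i<N. \<Sum>j<N'. cut2 n i j * H n i j)"
        using n by (intro sum.cong) (auto simp: cut2_def G_def)
      also have "\<dots> \<le> (\<Sum>i<N. \<Sum>j\<le>n. cut2 n i j * H n i j)"
        using n H(1) K by (intro sum_mono sum_mono2) (auto simp: cut2_def)
      also have "\<dots> \<le> (\<Sum>i\<le>n. \<Sum>j\<le>n. cut2 n i j * H n i j)"
        using n H(1) K by (intro sum_mono2 sum_nonneg) (auto simp: cut2_def)
      finally show ?thesis using 1 2 H(4)[of n] by linarith
    qed
    moreover have "\<forall>\<^sub>F n in sequentially. s n \<ge> max N N'"
      using s_top unfolding filterlim_at_top by blast
    ultimately have "\<forall>\<^sub>F n in sequentially.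
        (\<Sum>i<N. W1 i * (m i - (\<Sum>j. G (s n) i j) - lump k (s n) (s n)))
        + (\<Sum>j<N. W2 j * (k j - (\<Sum>i. G (s n) i j) - lump m (s n) (s n)))
        + (\<Sum>i<N. \<Sum>j<N'. K i j * G (s n) i j) \<le> D"
      by (auto elim!: eventually_mono)
    from tendsto_upperbound[OF lim this] show ?thesis by simp
  qed
  have pos: "0 \<le> W1 i * (m i - (\<Sum>j. g i j))" "0 \<le> W2 j * (k j - (\<Sum>i. g i j))"
    "0 \<le> K i j * g i j" for i j
    using W K g0 row_le col_le by (auto intro!: mult_nonneg_nonneg)
  let ?A = "\<lambda>i. ennreal (W1 i * (m i - (\<Sum>j. g i j)))"
  let ?B = "\<lambda>j. ennreal (W2 j * (k j - (\<Sum>i. g i j)))"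
  let ?C = "\<lambda>i j. ennreal (K i j * g i j)"
  have part': "(\<Sum>i<N. ?A i) + (\<Sum>j<N. ?B j) + (\<Sum>i<N. \<Sum>j<N'. ?C i j) \<le> ennreal D" for N N'
    using part[of N N'] pos
    by (simp add: sum_ennreal sum_nonneg ennreal_leI flip: ennreal_plus)
  \<comment> \<open>First the inner truncation \<open>N'\<close> tends to infinity with
    \<open>N\<close> fixed, then \<open>N\<close>. This is why \<open>part\<close> keeps two
    separate bounds.\<close>
  have "(\<Sum>i<N. ?A i) + (\<Sum>j<N. ?B j) + (\<Sum>i<N. \<Sum>j. ?C i j) \<le> ennreal D" for N
    by (rule LIMSEQ_le_const2[where X = "\<lambda>N'. (\<Sum>i<N. ?A i) + (\<Sum>j<N. ?B j) + (\<Sum>i<N. \<Sum>j<N'. ?C i j)"])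
       (use part' in \<open>auto intro!: tendsto_intros summable_LIMSEQ\<close>)
  then have "(\<Sum>i. ?A i) + (\<Sum>j. ?B j) + (\<Sum>i. \<Sum>j. ?C i j) \<le> ennreal D"
    by (intro LIMSEQ_le_const2[where X = "\<lambda>N. (\<Sum>i<N. ?A i) + (\<Sum>j<N. ?B j) + (\<Sum>i<N. \<Sum>j. ?C i j)"])
       (auto intro!: tendsto_intros summable_LIMSEQ)
  then show ?thesis using that[of g] g0 row(1) col(1) row_le col_le by blast
qed

section \<open>Weak duality\<close>

text \<open>The identity is measurable in both directions: the projections are continuous, and by
  second countability a pair of Borel functions is Borel. The result moves between the Borel sets of
  \<open>T \<times> T\<close> that plans use and the product measure from which a plan is
  built.\<close>

lemma sets_restrict_space_Times:
  fixes T :: "'a::second_countable_topology set" and S :: "'b::second_countable_topology set"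
  shows "sets (restrict_space borel (T \<times> S)) = sets (restrict_space borel T \<Otimes>\<^sub>M restrict_space borel S)"
    (is "sets ?L = sets ?R")
proof
  have sp: "space ?L = T \<times> S" "space ?R = T \<times> S"
    by (auto simp: space_restrict_space space_pair_measure)
  have 1: "fst \<in> measurable ?L (restrict_space borel T)" "snd \<in> measurable ?L (restrict_space borel S)"
    by (auto intro!: measurable_restrict_space3 borel_measurable_continuous_onI continuous_intros)
  have f: "(\<lambda>z. z) \<in> measurable ?L ?R"
    using measurable_Pair[OF 1] by simp
  have "(\<lambda>z. (fst z, snd z)) \<in> measurable ?R borel"
    by (intro borel_measurable_Pair measurable_compose[OF measurable_fst] measurable_compose[OF measurable_snd]
          measurable_restrict_space1 measurable_ident_sets refl)
  then have g: "(\<lambda>z. z) \<in> measurable ?R ?L"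
    by (intro measurable_restrict_space2) (auto simp: sp)
  show "sets ?R \<subseteq> sets ?L"
    using measurable_sets[OF f] sets.sets_into_space[of _ ?R] sp by (fastforce simp: Int_absorb2)
  show "sets ?L \<subseteq> sets ?R"
    using measurable_sets[OF g] sets.sets_into_space[of _ ?L] sp by (fastforce simp: Int_absorb2)
qed

text \<open>On the set where \<open>f > 1\<close> the density exceeds \<open>M\<close> by the
  integral of \<open>f - 1\<close>. Finiteness of \<open>M\<close> permits cancelling the mass of
  that set, so the excess is zero and the set is null.\<close>

lemma AE_le_one_of_density_le:
  fixes f :: "'a \<Rightarrow> real"
  assumes "finite_measure M" and [measurable]: "f \<in> borel_measurable M"
    and le: "\<And>A. A \<in> sets M \<Longrightarrow> emeasure (density M (\<lambda>x. ennreal (f x))) A \<le> emeasure M A"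
  shows "AE x in M. f x \<le> 1"
proof -
  interpret finite_measure M by fact
  define A where "A = {x \<in> space M. 1 < f x}"
  have [measurable]: "A \<in> sets M" unfolding A_def by measurable
  have "(\<integral>\<^sup>+x. ennreal (f x - 1) * indicator A x \<partial>M) + emeasure M A
      = (\<integral>\<^sup>+x. ennreal (f x - 1) * indicator A x + indicator A x \<partial>M)"
    by (subst nn_integral_add) auto
  also have "\<dots> = (\<integral>\<^sup>+x. ennreal (f x) * indicator A x \<partial>M)"
  proof (intro nn_integral_cong)
    fix x
    have "ennreal (f x - 1) + 1 = ennreal (f x)" if "1 < f x"
      using that ennreal_plus[of "f x - 1" 1] by simp
    then show "ennreal (f x - 1) * indicator A x + indicator A x = ennreal (f x) * indicator A x"
      by (auto simp: A_def split: split_indicator)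
  qed
  also have "\<dots> \<le> emeasure M A" using le[of A] by (simp add: emeasure_density)
  finally have "emeasure M A + (\<integral>\<^sup>+x. ennreal (f x - 1) * indicator A x \<partial>M) \<le> emeasure M A + 0"
    by (simp add: add.commute)
  then have "(\<integral>\<^sup>+x. ennreal (f x - 1) * indicator A x \<partial>M) = 0"
    using emeasure_finite[of A] by (simp only: ennreal_add_left_cancel_le) simp
  then have "AE x in M. ennreal (f x - 1) * indicator A x = 0"
    by (subst (asm) nn_integral_0_iff_AE) auto
  then show ?thesis
    by (rule AE_mp) (auto intro!: AE_I2 simp: A_def ennreal_eq_0_iff split: split_indicator_asm)
qed

text \<open>\<open>ennreal\<close> replaces negative values of \<open>g\<close> by \<open>0\<close>,
  so the comparison passes through the positive part of \<open>h\<close>.\<close>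

lemma ereal_integral_le_nn_integral:
  fixes h :: "'a \<Rightarrow> real"
  assumes h: "integrable M h" and le: "AE x in M. h x \<le> g x"
  shows "ereal (\<integral>x. h x \<partial>M) \<le> enn2ereal (\<integral>\<^sup>+x. ennreal (g x) \<partial>M)"
proof -
  have int: "integrable M (\<lambda>x. max 0 (h x))" using h by auto
  have "ereal (\<integral>x. h x \<partial>M) \<le> ereal (\<integral>x. max 0 (h x) \<partial>M)"
    using h int by (auto intro!: integral_mono)
  also have "\<dots> = enn2ereal (ennreal (\<integral>x. max 0 (h x) \<partial>M))" by simp
  also have "ennreal (\<integral>x. max 0 (h x) \<partial>M) = (\<integral>\<^sup>+x. ennreal (max 0 (h x)) \<partial>M)"
    by (rule nn_integral_eq_integral[symmetric, OF int]) auto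
  also have "enn2ereal \<dots> \<le> enn2ereal (\<integral>\<^sup>+x. ennreal (g x) \<partial>M)"
  proof (subst less_eq_ennreal.rep_eq[symmetric], rule nn_integral_mono_AE)
    show "AE x in M. ennreal (max 0 (h x)) \<le> ennreal (g x)"
      using le by eventually_elim (auto simp: max_def intro: ennreal_leI)
  qed
  finally show ?thesis .
qed

lemma tree_measuresD:
  assumes "\<mu> \<in> tree_measures T"
  shows "finite_measure \<mu>" "space \<mu> = T" "sets \<mu> = sets (restrict_space borel T)"
proof -
  show s: "sets \<mu> = sets (restrict_space borel T)" using assms by (simp add: tree_measures_def)
  then show sp: "space \<mu> = T" by (auto dest: sets_eq_imp_space_eq simp: space_restrict_space)
  show "finite_measure \<mu>"
    using assms by (intro finite_measureI) (auto simp: sp tree_measures_def)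
qed

lemma finite_treeD:
  assumes "finite_tree T"
  shows "compact T" "T \<noteq> {}"
  using assms by (auto simp: finite_tree_def intro!: compact_UN)

section \<open>Plans against dual pairs\<close>

text \<open>The integral of \<open>u\<close> splits into a part with density \<open>1 - f1\<close>,
  at most the first weight term, and a part with density \<open>f1\<close>, which is the integral of
  \<open>u (fst z)\<close> against \<open>\<gamma>\<close>. The same holds for \<open>v\<close>, and
  on \<open>T \<times> T\<close> the sum of the two potentials is at most the cost.\<close>

lemma ET_objective_ge_dual:
  fixes T :: "'a::euclidean_space set"
  assumes T: "compact T" and b: "0 \<le> b"
    and c: "continuous_on (T \<times> T) (\<lambda>z. c (fst z) (snd z))"
    and \<mu>: "\<mu> \<in> tree_measures T" and \<nu>: "\<nu> \<in> tree_measures T"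
    and p: "(\<gamma>, f1, f2) \<in> partial_plans T \<mu> \<nu>" and uv: "(u, v) \<in> dual_set T b c w1 w2 lam \<mu> \<nu>"
  shows "ereal ((\<integral>x. u x \<partial>\<mu>) + (\<integral>y. v y \<partial>\<nu>)) \<le> ET_objective b c w1 w2 lam \<mu> \<nu> (\<gamma>, f1, f2)"
proof -
  have s\<gamma>: "sets \<gamma> = sets (restrict_space borel (T \<times> T))" and "emeasure \<gamma> (T \<times> T) < \<infinity>"
    and f: "f1 \<in> borel_measurable \<mu>" "f2 \<in> borel_measurable \<nu>"
      "\<And>x. x \<in> T \<Longrightarrow> 0 \<le> f1 x" "\<And>x. x \<in> T \<Longrightarrow> 0 \<le> f2 x"
    and le: "\<And>A. A \<in> sets \<mu> \<Longrightarrow> emeasure (distr \<gamma> (restrict_space borel T) fst) A \<le> emeasure \<mu> A"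
      "\<And>A. A \<in> sets \<nu> \<Longrightarrow> emeasure (distr \<gamma> (restrict_space borel T) snd) A \<le> emeasure \<nu> A"
    and marg: "distr \<gamma> (restrict_space borel T) fst = density \<mu> (\<lambda>x. ennreal (f1 x))"
      "distr \<gamma> (restrict_space borel T) snd = density \<nu> (\<lambda>x. ennreal (f2 x))"
    using p by (auto simp: partial_plans_def)
  have sp: "space \<gamma> = T \<times> T"
    using sets_eq_imp_space_eq[OF s\<gamma>] by (simp add: space_restrict_space)
  interpret \<gamma>: finite_measure \<gamma>
    using \<open>emeasure \<gamma> (T \<times> T) < \<infinity>\<close> by (intro finite_measureI) (simp add: sp)
  have uv': "integrable \<mu> u" "integrable \<nu> v" "\<And>x. x \<in> T \<Longrightarrow> u x \<le> w1 x" "\<And>y. y \<in> T \<Longrightarrow> v y \<le> w2 y"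
    "\<And>x y. x \<in> T \<Longrightarrow> y \<in> T \<Longrightarrow> u x + v y \<le> b * (c x y - lam)"
    using uv by (simp_all add: dual_set_def)
  \<comment> \<open>One statement serves both marginals: \<open>proj\<close> is \<open>fst\<close>
    with \<open>u\<close> and \<open>\<mu>\<close>, or \<open>snd\<close> with \<open>v\<close> and
    \<open>\<nu>\<close>. The term moved to the right is finite, so a weight term equal to infinity
    causes no trouble.\<close>
  have side: "integrable \<gamma> (\<lambda>z. h (proj z)) \<and> ereal (\<integral>x. h x \<partial>M)
      \<le> enn2ereal (\<integral>\<^sup>+x. ennreal (w x * (1 - f x)) \<partial>M) + ereal (\<integral>z. h (proj z) \<partial>\<gamma>)"
    if M: "M \<in> tree_measures T" and proj: "proj = fst \<or> proj = snd" and h: "integrable M h"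
      and hw: "\<And>x. x \<in> T \<Longrightarrow> h x \<le> w x"
      and f[measurable]: "f \<in> borel_measurable M" and f0: "\<And>x. x \<in> T \<Longrightarrow> 0 \<le> f x"
      and le: "\<And>A. A \<in> sets M \<Longrightarrow> emeasure (distr \<gamma> (restrict_space borel T) proj) A \<le> emeasure M A"
      and marg: "distr \<gamma> (restrict_space borel T) proj = density M (\<lambda>x. ennreal (f x))"
    for M and proj :: "'a \<times> 'a \<Rightarrow> 'a" and h w f
  proof -
    note M' = tree_measuresD[OF M]
    have [measurable]: "proj \<in> measurable \<gamma> (restrict_space borel T)"
      unfolding measurable_cong_sets[OF s\<gamma> refl] using proj
      by (auto intro!: measurable_restrict_space3 borel_measurable_continuous_onI continuous_intros)
    have hm[measurable]: "h \<in> borel_measurable M" using h by auto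
    have hm'[measurable]: "h \<in> borel_measurable (restrict_space borel T)"
      using hm by (simp add: measurable_cong_sets[OF M'(3) refl])
    have f0': "AE x in M. 0 \<le> f x" using f0 by (auto simp: M')
    have f1: "AE x in M. f x \<le> 1"
      by (rule AE_le_one_of_density_le[OF M'(1) f]) (use le in \<open>simp add: marg\<close>)
    have int: "integrable M (\<lambda>x. f x * h x)"
    proof (rule Bochner_Integration.integrable_bound[OF h])
      show "AE x in M. norm (f x * h x) \<le> norm (h x)"
        using f0' f1 by eventually_elim (auto simp: abs_mult intro: mult_left_le_one_le)
    qed measurable
    have int': "integrable \<gamma> (\<lambda>z. h (proj z))"
      using int f0' by (subst integrable_distr_eq[symmetric, where N = "restrict_space borel T"])
        (auto simp: marg integrable_density)
    have eq: "(\<integral>z. h (proj z) \<partial>\<gamma>) = (\<integral>x. f x * h x \<partial>M)"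
      using f0' by (subst integral_distr[symmetric, where N = "restrict_space borel T"])
        (auto simp: marg integral_density)
    have diff: "integrable M (\<lambda>x. h x - f x * h x)" using h int by auto
    have "ereal (\<integral>x. h x - f x * h x \<partial>M) \<le> enn2ereal (\<integral>\<^sup>+x. ennreal (w x * (1 - f x)) \<partial>M)"
    proof (rule ereal_integral_le_nn_integral[OF diff])
      show "AE x in M. h x - f x * h x \<le> w x * (1 - f x)"
        using f1 AE_space
      proof eventually_elim
        case (elim x)
        then have "h x * (1 - f x) \<le> w x * (1 - f x)"
          using hw[of x] by (intro mult_right_mono) (auto simp: M')
        then show ?case by (simp add: algebra_simps)
      qed
    qed
    then have "ereal (\<integral>x. h x - f x * h x \<partial>M) + ereal (\<integral>z. h (proj z) \<partial>\<gamma>)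
        \<le> enn2ereal (\<integral>\<^sup>+x. ennreal (w x * (1 - f x)) \<partial>M) + ereal (\<integral>z. h (proj z) \<partial>\<gamma>)"
      by (rule add_right_mono)
    moreover have "(\<integral>x. h x \<partial>M) = (\<integral>x. h x - f x * h x \<partial>M) + (\<integral>z. h (proj z) \<partial>\<gamma>)"
      using h int by (simp add: eq)
    ultimately show ?thesis using int' by simp
  qed
  note 1 = side[OF \<mu> disjI1[OF refl] uv'(1,3) f(1,3) le(1) marg(1)]
  note 2 = side[OF \<nu> disjI2[OF refl] uv'(2,4) f(2,4) le(2) marg(2)]
  have cm: "(\<lambda>z. c (fst z) (snd z)) \<in> borel_measurable \<gamma>"
    unfolding measurable_cong_sets[OF s\<gamma> refl]
    by (rule borel_measurable_continuous_on_restrict[OF c])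
  have "bounded ((\<lambda>z. c (fst z) (snd z)) ` (T \<times> T))"
    by (intro compact_imp_bounded compact_continuous_image c compact_Times T)
  then obtain B where B: "\<And>z. z \<in> T \<times> T \<Longrightarrow> \<bar>c (fst z) (snd z)\<bar> \<le> B"
    by (force simp: bounded_iff)
  \<comment> \<open>Integrability is essential for the comparison below, since the Bochner integral
    of a non-integrable function is \<open>0\<close> by convention.\<close>
  have ci: "integrable \<gamma> (\<lambda>z. c (fst z) (snd z))"
    by (rule \<gamma>.integrable_const_bound[OF _ cm, of B]) (use B in \<open>auto simp: sp\<close>)
  have "(\<integral>z. u (fst z) \<partial>\<gamma>) + (\<integral>z. v (snd z) \<partial>\<gamma>) = (\<integral>z. u (fst z) + v (snd z) \<partial>\<gamma>)"
    using 1 2 by simp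
  also have "\<dots> \<le> (\<integral>z. b * (c (fst z) (snd z) - lam) \<partial>\<gamma>)"
    using 1 2 ci uv'(5) by (intro integral_mono) (auto simp: sp)
  also have "\<dots> = b * (\<integral>z. c (fst z) (snd z) - lam \<partial>\<gamma>)"
    by simp
  finally have 3: "ereal (\<integral>z. u (fst z) \<partial>\<gamma>) + ereal (\<integral>z. v (snd z) \<partial>\<gamma>)
      \<le> ereal (b * (\<integral>z. c (fst z) (snd z) - lam \<partial>\<gamma>))"
    by simp
  have "ereal ((\<integral>x. u x \<partial>\<mu>) + (\<integral>y. v y \<partial>\<nu>)) = ereal (\<integral>x. u x \<partial>\<mu>) + ereal (\<integral>y. v y \<partial>\<nu>)"
    by simp
  also have "\<dots> \<le> (enn2ereal (\<integral>\<^sup>+x. ennreal (w1 x * (1 - f1 x)) \<partial>\<mu>) + ereal (\<integral>z. u (fst z) \<partial>\<gamma>))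
      + (enn2ereal (\<integral>\<^sup>+x. ennreal (w2 x * (1 - f2 x)) \<partial>\<nu>) + ereal (\<integral>z. v (snd z) \<partial>\<gamma>))"
    using 1 2 by (intro add_mono) auto
  also have "\<dots> = enn2ereal (\<integral>\<^sup>+x. ennreal (w1 x * (1 - f1 x)) \<partial>\<mu>)
      + enn2ereal (\<integral>\<^sup>+x. ennreal (w2 x * (1 - f2 x)) \<partial>\<nu>)
      + (ereal (\<integral>z. u (fst z) \<partial>\<gamma>) + ereal (\<integral>z. v (snd z) \<partial>\<gamma>))"
    by (simp only: add.assoc add.commute add.left_commute)
  also have "\<dots> \<le> ET_objective b c w1 w2 lam \<mu> \<nu> (\<gamma>, f1, f2)"
    unfolding ET_objective_def split by (intro add_left_mono 3)
  finally show ?thesis .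
qed

section \<open>Discretisation\<close>

text \<open>The lower bound on \<open>v\<close> in the dual set costs nothing: \<open>U \<le> w1\<close> makes the \<open>c\<close>-transform
  satisfy it, and \<open>w2\<close> satisfies it because \<open>c\<close> vanishes on the diagonal.\<close>

lemma dual_set_c_transform:
  fixes T :: "'a::euclidean_space set"
  assumes T: "compact T" "T \<noteq> {}" and b: "0 \<le> b" and lam: "0 \<le> lam"
    and c: "continuous_on (T \<times> T) (\<lambda>z. c (fst z) (snd z))" "\<And>x. x \<in> T \<Longrightarrow> c x x = 0"
    and w: "\<And>x. x \<in> T \<Longrightarrow> 0 \<le> w1 x" "\<And>x. x \<in> T \<Longrightarrow> 0 \<le> w2 x"
      "w2 \<in> borel_measurable (restrict_space borel T)"
    and \<mu>: "\<mu> \<in> tree_measures T" and \<nu>: "\<nu> \<in> tree_measures T"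
    and U: "U \<in> borel_measurable \<mu>" "\<And>x. x \<in> T \<Longrightarrow> \<bar>U x\<bar> \<le> B" "\<And>x. x \<in> T \<Longrightarrow> U x \<le> w1 x"
  shows "(U, \<lambda>y. min (w2 y) (INF x\<in>T. b * (c x y - lam) - U x)) \<in> dual_set T b c w1 w2 lam \<mu> \<nu>"
proof -
  define Q where "Q y = (INF x\<in>T. b * (c x y - lam) - U x)" for y
  have "bounded ((\<lambda>z. b * (c (fst z) (snd z) - lam)) ` (T \<times> T))"
    by (intro compact_imp_bounded compact_continuous_image continuous_intros c compact_Times T)
  then obtain M where M: "\<And>x y. x \<in> T \<Longrightarrow> y \<in> T \<Longrightarrow> \<bar>b * (c x y - lam)\<bar> \<le> M"
    by (force simp: bounded_iff)
  have low: "- M - B \<le> b * (c x y - lam) - U x" if "x \<in> T" "y \<in> T" for x y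
    using M[OF that] U(2)[OF that(1)] by linarith
  have bdd: "bdd_below ((\<lambda>x. b * (c x y - lam) - U x) ` T)" if "y \<in> T" for y
    using low[OF _ that] by (auto simp: bdd_below_def)
  have Q_le: "Q y \<le> b * (c x y - lam) - U x" if "x \<in> T" "y \<in> T" for x y
    unfolding Q_def by (rule cINF_lower[OF bdd[OF that(2)] that(1)])
  have Q_ge: "a \<le> Q y" if "\<And>x. x \<in> T \<Longrightarrow> a \<le> b * (c x y - lam) - U x" for a y
    unfolding Q_def by (rule cINF_greatest[OF T(2) that])
  obtain t where t: "t \<in> T" using T(2) by auto
  have Q_bd: "- M - B \<le> Q y" "Q y \<le> M + B" if "y \<in> T" for y
    using Q_ge[of "- M - B" y] low[OF _ that] Q_le[OF t that] M[OF t that] U(2)[OF t] by auto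
  \<comment> \<open>The infimum runs over a possibly uncountable set, so measurability comes from
    upper semicontinuity: each set \<open>Q < a\<close> is a union of relatively open sets.\<close>
  have Q_meas: "Q \<in> borel_measurable (restrict_space borel T)"
    unfolding borel_measurable_iff_less
  proof
    fix a
    have "{y \<in> space (restrict_space borel T). Q y < a} = (\<Union>x\<in>T. {y \<in> T. b * (c x y - lam) - U x < a})"
      unfolding Q_def space_restrict_space using cINF_less_iff[OF T(2) bdd] by auto
    also have "openin (top_of_set T) \<dots>"
    proof (rule openin_Union, safe)
      fix x assume x: "x \<in> T"
      have "continuous_on T (\<lambda>y. (\<lambda>z. c (fst z) (snd z)) (x, y))"
        by (rule continuous_on_compose2[OF c(1)]) (auto intro!: continuous_intros simp: x)
      then have "continuous_on T (\<lambda>y. b * (c x y - lam) - U x)"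
        by (auto intro!: continuous_intros)
      from continuous_openin_preimage_gen[OF this, of "{..<a}"]
      show "openin (top_of_set T) {y \<in> T. b * (c x y - lam) - U x < a}"
        by (simp add: vimage_def Int_def)
    qed
    finally obtain O' where "open O'" "{y \<in> space (restrict_space borel T). Q y < a} = T \<inter> O'"
      by (auto simp: openin_open)
    then show "{y \<in> space (restrict_space borel T). Q y < a} \<in> sets (restrict_space borel T)"
      by (auto simp: sets_restrict_space)
  qed
  note \<mu>' = tree_measuresD[OF \<mu>] and \<nu>' = tree_measuresD[OF \<nu>]
  have "integrable \<mu> U"
    by (rule finite_measure.integrable_const_bound[OF \<mu>'(1) _ U(1), of B]) (use U(2) in \<open>auto simp: \<mu>'\<close>)
  moreover have "integrable \<nu> (\<lambda>y. min (w2 y) (Q y))"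
  proof (rule finite_measure.integrable_const_bound[OF \<nu>'(1), of _ "M + B"])
    show "AE y in \<nu>. norm (min (w2 y) (Q y)) \<le> M + B"
      using Q_bd w(2) by (force simp: \<nu>' min_def)
    show "(\<lambda>y. min (w2 y) (Q y)) \<in> borel_measurable \<nu>"
      unfolding measurable_cong_sets[OF \<nu>'(3) refl] using Q_meas w(3) by measurable
  qed
  moreover have "ereal (- b * lam) + (INF x\<in>T. ereal (b * c x y - w1 x)) \<le> ereal (min (w2 y) (Q y))"
    if y: "y \<in> T" for y
  \<comment> \<open>If \<open>w1\<close> is unbounded on \<open>T\<close> the infimum is
    \<open>-\<infinity>\<close> and the lower bound is vacuous; otherwise it is a real number
    \<open>r\<close>.\<close>
  proof (cases "(INF x\<in>T. ereal (b * c x y - w1 x)) = -\<infinity>")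
    case False
    let ?I = "INF x\<in>T. ereal (b * c x y - w1 x)"
    have I: "?I \<le> ereal (b * c x y - w1 x)" if "x \<in> T" for x using that by (rule INF_lower)
    then obtain r where r: "?I = ereal r"
      using False t by (cases ?I) fastforce+
    \<comment> \<open>Evaluating the infimum at \<open>x = y\<close>, where the cost vanishes, gives
      \<open>r \<le> - w1 y\<close>, so the left side is at most \<open>0\<close>.\<close>
    have "- b * lam + r \<le> w2 y"
      using I[OF y] w(1,2)[OF y] c(2)[OF y] mult_nonneg_nonneg[OF b lam] by (simp add: r)
    moreover have "- b * lam + r \<le> Q y"
    proof (rule Q_ge)
      fix x assume "x \<in> T"
      then show "- b * lam + r \<le> b * (c x y - lam) - U x"
        using I[of x] U(3)[of x] by (simp add: r algebra_simps)
    qed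
    ultimately show ?thesis by (simp add: r)
  qed simp
  moreover have "U x + min (w2 y) (Q y) \<le> b * (c x y - lam)" if "x \<in> T" "y \<in> T" for x y
    using Q_le[OF that] by linarith
  ultimately show ?thesis using U(3) by (simp add: dual_set_def Q_def)
qed

section \<open>Countable partitions and integrals over their fibres\<close>

text \<open>A point is labelled by the first member of a countable dense sequence within
  \<open>e / 2\<close> of its image; equal labels then give images closer than \<open>e\<close>. The
  partition is countable rather than finite, so \<open>F\<close> may be unbounded.\<close>

lemma measurable_index_small_fibres:
  fixes F :: "'a \<Rightarrow> 'b::{metric_space, second_countable_topology}"
  assumes [measurable]: "F \<in> borel_measurable M" and e: "0 < e"
  obtains I :: "'a \<Rightarrow> nat" where "I \<in> measurable M (count_space UNIV)"
    "\<And>x y. I x = I y \<Longrightarrow> dist (F x) (F y) < e"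
proof -
  obtain D :: "'b set" where D: "countable D" "\<And>X. open X \<Longrightarrow> X \<noteq> {} \<Longrightarrow> \<exists>d\<in>D. d \<in> X"
    using countable_dense_exists by blast
  have D0: "D \<noteq> {}" using D(2)[of UNIV] by auto
  define q where "q = from_nat_into D"
  define I where "I x = (LEAST n. dist (F x) (q n) < e / 2)" for x
  have I: "dist (F x) (q (I x)) < e / 2" for x
  proof -
    obtain d where "d \<in> D" "dist (F x) d < e / 2"
      using D(2)[of "ball (F x) (e / 2)"] e by auto
    moreover have "\<exists>n. q n = d"
      using from_nat_into_surj[OF D(1) \<open>d \<in> D\<close>] by (simp add: q_def)
    ultimately have "\<exists>n. dist (F x) (q n) < e / 2" by blast
    then show ?thesis unfolding I_def by (rule LeastI_ex)
  qed
  show ?thesis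
  proof (rule that)
    show "I \<in> measurable M (count_space UNIV)" unfolding I_def by measurable
    show "dist (F x) (F y) < e" if "I x = I y" for x y
      using I[of x] I[of y] that dist_triangle_half_l[of "F x" "q (I x)" e "F y"] by simp
  qed
qed

lemma nn_integral_fibres:
  fixes I :: "'a \<Rightarrow> nat" and h :: "nat \<Rightarrow> ennreal"
  assumes "finite_measure M" and [measurable]: "I \<in> measurable M (count_space UNIV)"
  shows "(\<integral>\<^sup>+x. h (I x) \<partial>M) = (\<Sum>i. h i * ennreal (measure M (I -` {i} \<inter> space M)))"
proof -
  interpret finite_measure M by fact
  have [measurable]: "I -` {i} \<inter> space M \<in> sets M" for i by measurable
  have "(\<integral>\<^sup>+x. h (I x) \<partial>M) = (\<integral>\<^sup>+x. (\<Sum>i. h i * indicator (I -` {i} \<inter> space M) x) \<partial>M)"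
  proof (rule nn_integral_cong)
    fix x assume "x \<in> space M"
    then have "(\<Sum>i. h i * indicator (I -` {i} \<inter> space M) x) = (\<Sum>i\<in>{I x}. h i * indicator (I -` {i} \<inter> space M) x)"
      by (intro suminf_finite) (auto split: split_indicator)
    then show "h (I x) = (\<Sum>i. h i * indicator (I -` {i} \<inter> space M) x)"
      using \<open>x \<in> space M\<close> by simp
  qed
  also have "\<dots> = (\<Sum>i. \<integral>\<^sup>+x. h i * indicator (I -` {i} \<inter> space M) x \<partial>M)"
    by (rule nn_integral_suminf) simp
  also have "\<dots> = (\<Sum>i. h i * ennreal (measure M (I -` {i} \<inter> space M)))"
    by (simp add: nn_integral_cmult_indicator emeasure_eq_measure)
  finally show ?thesis .
qed

lemma summable_fibre_measure:
  fixes I :: "'a \<Rightarrow> nat"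
  assumes M: "finite_measure M" and I: "I \<in> measurable M (count_space UNIV)"
  shows "summable (\<lambda>i. measure M (I -` {i} \<inter> space M))"
proof (rule summable_suminf_not_top)
  interpret finite_measure M by fact
  have "(\<Sum>i. ennreal (measure M (I -` {i} \<inter> space M))) = emeasure M (space M)"
    using nn_integral_fibres[OF M I, of "\<lambda>_. 1"] by simp
  then show "(\<Sum>i. ennreal (measure M (I -` {i} \<inter> space M))) \<noteq> top"
    by (simp add: emeasure_eq_measure)
qed simp

text \<open>A finite range makes \<open>u\<close> bounded, hence integrable against a finite
  measure, and the integral is then countably additive over the fibres.\<close>

lemma integral_fibres:
  fixes I :: "'a \<Rightarrow> nat" and u :: "nat \<Rightarrow> real"
  assumes M: "finite_measure M" and I[measurable]: "I \<in> measurable M (count_space UNIV)"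
    and u: "finite (range u)"
  shows "integrable M (\<lambda>x. u (I x))"
    and "(\<integral>x. u (I x) \<partial>M) = (\<Sum>i. u i * measure M (I -` {i} \<inter> space M))"
proof -
  interpret finite_measure M by fact
  let ?m = "\<lambda>i. measure M (I -` {i} \<inter> space M)"
  obtain B where "\<forall>a\<in>range u. norm a \<le> B"
    using finite_imp_bounded[OF u] unfolding bounded_iff by blast
  then have B: "\<bar>u i\<bar> \<le> B" for i by auto
  show int: "integrable M (\<lambda>x. u (I x))"
    by (rule integrable_const_bound[of _ B]) (use B in auto)
  define A where "A i = I -` {i} \<inter> space M" for i
  have [measurable]: "A i \<in> sets M" for i unfolding A_def by measurable
  have "(\<integral>x. u (I x) \<partial>M) = (LINT x:(\<Union>i. A i)|M. u (I x))"
    unfolding set_lebesgue_integral_def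
    by (intro Bochner_Integration.integral_cong) (auto simp: A_def split: split_indicator)
  also have "\<dots> = (\<Sum>i. LINT x:A i|M. u (I x))"
  proof (rule lebesgue_integral_countable_add)
    show "set_integrable M (\<Union>i. A i) (\<lambda>x. u (I x))"
      unfolding set_integrable_def by (intro integrable_mult_indicator int) measurable
  qed (auto simp: A_def)
  also have "\<dots> = (\<Sum>i. u i * measure M (A i))"
  proof (rule suminf_cong)
    fix i
    have "(LINT x:A i|M. u (I x)) = (\<integral>x. indicator (A i) x * u i \<partial>M)"
      unfolding set_lebesgue_integral_def
      by (intro Bochner_Integration.integral_cong) (auto simp: A_def split: split_indicator)
    then show "(LINT x:A i|M. u (I x)) = u i * measure M (A i)"
      by (simp add: A_def Int_absorb2)
  qed
  finally show "(\<integral>x. u (I x) \<partial>M) = (\<Sum>i. u i * measure M (I -` {i} \<inter> space M))"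
    by (simp add: A_def)
qed

section \<open>Discrete plans realised as measures\<close>

text \<open>\<open>P\<close> spreads the mass \<open>g i j\<close> over the rectangle of the fibres
  \<open>i\<close> and \<open>j\<close> proportionally to the product measure. Its marginals
  therefore have densities constant on fibres, namely the row sum over \<open>m i\<close> and the
  column sum over \<open>k j\<close>, and a cost depending only on the labels integrates to the
  discrete cost.\<close>

lemma fibrewise_plan:
  fixes I :: "'a \<Rightarrow> nat" and J :: "'b \<Rightarrow> nat" and g :: "nat \<Rightarrow> nat \<Rightarrow> real"
  assumes M: "finite_measure M" and I[measurable]: "I \<in> measurable M (count_space UNIV)"
    and N: "finite_measure N" and J[measurable]: "J \<in> measurable N (count_space UNIV)"
    and g0: "\<And>i j. 0 \<le> g i j" "\<And>i. summable (g i)" "\<And>j. summable (\<lambda>i. g i j)"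
    and row: "\<And>i. (\<Sum>j. g i j) \<le> measure M (I -` {i} \<inter> space M)"
    and col: "\<And>j. (\<Sum>i. g i j) \<le> measure N (J -` {j} \<inter> space N)"
  defines "m \<equiv> \<lambda>i. measure M (I -` {i} \<inter> space M)"
    and "k \<equiv> \<lambda>j. measure N (J -` {j} \<inter> space N)"
  defines "P \<equiv> density (M \<Otimes>\<^sub>M N) (\<lambda>z. ennreal (g (I (fst z)) (J (snd z)) / (m (I (fst z)) * k (J (snd z)))))"
  shows "A \<in> sets M \<Longrightarrow> emeasure P (A \<times> space N) = (\<integral>\<^sup>+x\<in>A. ennreal ((\<Sum>j. g (I x) j) / m (I x)) \<partial>M)"
    and "B \<in> sets N \<Longrightarrow> emeasure P (space M \<times> B) = (\<integral>\<^sup>+y\<in>B. ennreal ((\<Sum>i. g i (J y)) / k (J y)) \<partial>N)"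
    and "(\<And>i j. 0 \<le> K i j) \<Longrightarrow>
      (\<integral>\<^sup>+z. ennreal (K (I (fst z)) (J (snd z))) \<partial>P) = (\<Sum>i. \<Sum>j. ennreal (K i j * g i j))"
proof -
  interpret M: finite_measure M by fact
  interpret N: finite_measure N by fact
  interpret MN: pair_sigma_finite M N ..
  have fibI: "(\<integral>\<^sup>+x. h (I x) \<partial>M) = (\<Sum>i. h i * ennreal (m i))" for h
    unfolding m_def by (rule nn_integral_fibres[OF M I])
  have fibJ: "(\<integral>\<^sup>+y. h (J y) \<partial>N) = (\<Sum>j. h j * ennreal (k j))" for h
    unfolding k_def by (rule nn_integral_fibres[OF N J])
  define q where "q i j = g i j / (m i * k j)" for i j
  have mk: "0 \<le> m i" "0 \<le> k j" for i j by (auto simp: m_def k_def)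
  have q0: "0 \<le> q i j" for i j using g0(1) mk by (simp add: q_def)
  \<comment> \<open>These bounds make \<open>g i j\<close> vanish wherever the quotient \<open>q i j\<close> has denominator \<open>0\<close>.\<close>
  have gm: "g i j \<le> m i" for i j
    using sum_le_suminf[OF g0(2), of "{j}" i] g0(1) row[of i] by (simp add: m_def)
  have gk: "g i j \<le> k j" for i j
    using sum_le_suminf[OF g0(3), of "{i}" j] g0(1) col[of j] by (simp add: k_def)
  have qk: "q i j * k j = g i j / m i" for i j
    using gk[of i j] g0(1)[of i j] by (cases "k j = 0") (auto simp: q_def)
  have qm: "q i j * m i = g i j / k j" for i j
    using gm[of i j] g0(1)[of i j] by (cases "m i = 0") (auto simp: q_def)
  have qkm: "q i j * k j * m i = g i j" for i j
    using gm[of i j] g0(1)[of i j] by (cases "m i = 0") (auto simp: qk)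
  have qmeas[measurable]: "(\<lambda>z. h (I (fst z)) (J (snd z))) \<in> borel_measurable (M \<Otimes>\<^sub>M N)"
    for h :: "nat \<Rightarrow> nat \<Rightarrow> real"
    by (rule measurable_compose_countable[where f = "\<lambda>i z. h i (J (snd z))" and g = "\<lambda>z. I (fst z)"])
       measurable
  have P: "P = density (M \<Otimes>\<^sub>M N) (\<lambda>z. ennreal (q (I (fst z)) (J (snd z))))"
    by (simp add: P_def q_def)
  have inner_y: "(\<integral>\<^sup>+y. ennreal (q i (J y)) \<partial>N) = ennreal ((\<Sum>j. g i j) / m i)" for i
  proof -
    have "(\<integral>\<^sup>+y. ennreal (q i (J y)) \<partial>N) = (\<Sum>j. ennreal (g i j / m i))"
      by (subst fibJ) (simp add: q0 mk qk flip: ennreal_mult)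
    also have "\<dots> = ennreal ((\<Sum>j. g i j) / m i)"
      using g0 mk by (simp add: suminf_ennreal2 summable_divide suminf_divide)
    finally show ?thesis .
  qed
  have inner_x: "(\<integral>\<^sup>+x. ennreal (q (I x) j) \<partial>M) = ennreal ((\<Sum>i. g i j) / k j)" for j
  proof -
    have "(\<integral>\<^sup>+x. ennreal (q (I x) j) \<partial>M) = (\<Sum>i. ennreal (g i j / k j))"
      by (subst fibI[of "\<lambda>i. ennreal (q i j)"]) (simp add: q0 mk qm flip: ennreal_mult)
    also have "\<dots> = ennreal ((\<Sum>i. g i j) / k j)"
      using g0 mk by (simp add: suminf_ennreal2 summable_divide suminf_divide)
    finally show ?thesis .
  qed
  show "emeasure P (A \<times> space N) = (\<integral>\<^sup>+x\<in>A. ennreal ((\<Sum>j. g (I x) j) / m (I x)) \<partial>M)" if [measurable]: "A \<in> sets M"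
  proof -
    have "emeasure P (A \<times> space N)
        = (\<integral>\<^sup>+z. ennreal (q (I (fst z)) (J (snd z))) * indicator (A \<times> space N) z \<partial>(M \<Otimes>\<^sub>M N))"
      unfolding P by (rule emeasure_density) auto
    also have "\<dots> = (\<integral>\<^sup>+x. \<integral>\<^sup>+y. ennreal (q (I x) (J y)) * indicator (A \<times> space N) (x, y) \<partial>N \<partial>M)"
      by (subst N.nn_integral_fst[symmetric]) auto
    also have "\<dots> = (\<integral>\<^sup>+x. (\<integral>\<^sup>+y. ennreal (q (I x) (J y)) \<partial>N) * indicator A x \<partial>M)"
      by (intro nn_integral_cong) (auto split: split_indicator intro!: nn_integral_cong)
    finally show ?thesis by (simp add: inner_y)
  qed
  show "emeasure P (space M \<times> B) = (\<integral>\<^sup>+y\<in>B. ennreal ((\<Sum>i. g i (J y)) / k (J y)) \<partial>N)" if [measurable]: "B \<in> sets N"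
  proof -
    have "emeasure P (space M \<times> B)
        = (\<integral>\<^sup>+z. ennreal (q (I (fst z)) (J (snd z))) * indicator (space M \<times> B) z \<partial>(M \<Otimes>\<^sub>M N))"
      unfolding P by (rule emeasure_density) auto
    also have "\<dots> = (\<integral>\<^sup>+y. \<integral>\<^sup>+x. ennreal (q (I x) (J y)) * indicator (space M \<times> B) (x, y) \<partial>M \<partial>N)"
      by (subst MN.nn_integral_snd[symmetric]) (auto simp: case_prod_beta')
    also have "\<dots> = (\<integral>\<^sup>+y. (\<integral>\<^sup>+x. ennreal (q (I x) (J y)) \<partial>M) * indicator B y \<partial>N)"
      by (intro nn_integral_cong) (auto split: split_indicator intro!: nn_integral_cong)
    finally show ?thesis by (simp add: inner_x)
  qed
  show "(\<integral>\<^sup>+z. ennreal (K (I (fst z)) (J (snd z))) \<partial>P) = (\<Sum>i. \<Sum>j. ennreal (K i j * g i j))"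
    if K: "\<And>i j. 0 \<le> K i j"
  proof -
    have "(\<integral>\<^sup>+z. ennreal (K (I (fst z)) (J (snd z))) \<partial>P)
        = (\<integral>\<^sup>+z. ennreal (q (I (fst z)) (J (snd z)) * K (I (fst z)) (J (snd z))) \<partial>(M \<Otimes>\<^sub>M N))"
      unfolding P by (subst nn_integral_density) (auto simp: ennreal_mult' q0)
    also have "\<dots> = (\<integral>\<^sup>+x. \<integral>\<^sup>+y. ennreal (q (I x) (J y) * K (I x) (J y)) \<partial>N \<partial>M)"
      by (subst N.nn_integral_fst[symmetric]) auto
    also have "\<dots> = (\<integral>\<^sup>+x. (\<Sum>j. ennreal (q (I x) j * K (I x) j) * ennreal (k j)) \<partial>M)"
      by (intro nn_integral_cong fibJ)
    also have "\<dots> = (\<Sum>i. (\<Sum>j. ennreal (q i j * K i j) * ennreal (k j)) * ennreal (m i))"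
      by (rule fibI)
    also have "\<dots> = (\<Sum>i. \<Sum>j. ennreal (q i j * K i j) * ennreal (k j) * ennreal (m i))"
      by simp
    also have "\<dots> = (\<Sum>i. \<Sum>j. ennreal (K i j * g i j))"
    proof (intro suminf_cong)
      fix i j
      have "q i j * K i j * k j * m i = K i j * g i j"
        by (subst qkm[symmetric]) (simp add: ac_simps)
      moreover have "ennreal (q i j * K i j) * ennreal (k j) * ennreal (m i) = ennreal (q i j * K i j * k j * m i)"
        using q0 K mk by (simp flip: ennreal_mult)
      ultimately show "ennreal (q i j * K i j) * ennreal (k j) * ennreal (m i) = ennreal (K i j * g i j)"
        by (simp only:)
    qed
    finally show ?thesis .
  qed
qed

text \<open>On fibre \<open>i\<close> the fraction \<open>1 - s i / m i\<close> is left over, which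
  is the mass \<open>m i - s i\<close> in total. The fraction is at most \<open>1\<close>, so an
  error \<open>e\<close> in the weight costs at most \<open>e\<close> times the whole mass. A fibre
  with \<open>m i = 0\<close> has \<open>s i = 0\<close> and contributes nothing to either
  side.\<close>

lemma nn_integral_defect_le:
  fixes I :: "'a \<Rightarrow> nat" and s W :: "nat \<Rightarrow> real"
  assumes M: "finite_measure M" and I[measurable]: "I \<in> measurable M (count_space UNIV)"
    and s: "\<And>i. 0 \<le> s i" "\<And>i. s i \<le> measure M (I -` {i} \<inter> space M)"
    and W: "\<And>i. 0 \<le> W i" and w: "\<And>x. x \<in> space M \<Longrightarrow> w x \<le> W (I x) + e" and e: "0 \<le> e"
  defines "m \<equiv> \<lambda>i. measure M (I -` {i} \<inter> space M)"
  shows "(\<integral>\<^sup>+x. ennreal (w x * (1 - s (I x) / m (I x))) \<partial>M)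
    \<le> (\<Sum>i. ennreal (W i * (m i - s i))) + ennreal (e * measure M (space M))"
proof -
  interpret finite_measure M by fact
  have m: "0 \<le> m i" "s i \<le> m i" for i using s(2) by (simp_all add: m_def)
  have frac: "0 \<le> s i / m i" "s i / m i \<le> 1" for i
    using s(1)[of i] m[of i] by (auto simp: divide_le_eq_1)
  define r where "r i = W i * (1 - s i / m i)" for i
  have r0: "0 \<le> r i" for i using frac W by (simp add: r_def)
  have "(\<integral>\<^sup>+x. ennreal (w x * (1 - s (I x) / m (I x))) \<partial>M) \<le> (\<integral>\<^sup>+x. ennreal (r (I x)) + ennreal e \<partial>M)"
  proof (rule nn_integral_mono)
    fix x assume "x \<in> space M"
    then have "w x * (1 - s (I x) / m (I x)) \<le> (W (I x) + e) * (1 - s (I x) / m (I x))"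
      using w frac by (intro mult_right_mono) auto
    also have "\<dots> \<le> r (I x) + e"
      using mult_nonneg_nonneg[OF e frac(1)[of "I x"]] by (simp add: r_def algebra_simps add_divide_distrib)
    finally show "ennreal (w x * (1 - s (I x) / m (I x))) \<le> ennreal (r (I x)) + ennreal e"
      using e r0 by (simp add: ennreal_leI flip: ennreal_plus)
  qed
  also have "\<dots> = (\<integral>\<^sup>+x. ennreal (r (I x)) \<partial>M) + ennreal (e * measure M (space M))"
    using e by (subst nn_integral_add) (auto simp: emeasure_eq_measure ennreal_mult)
  also have "(\<integral>\<^sup>+x. ennreal (r (I x)) \<partial>M) = (\<Sum>i. ennreal (r i) * ennreal (m i))"
    unfolding m_def by (rule nn_integral_fibres[OF M I])
  also have "\<dots> = (\<Sum>i. ennreal (W i * (m i - s i)))"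
  proof (rule suminf_cong)
    fix i
    have "r i * m i = W i * (m i - s i)"
      using s(1)[of i] m[of i] by (cases "m i = 0") (auto simp: r_def field_simps)
    then show "ennreal (r i) * ennreal (m i) = ennreal (W i * (m i - s i))"
      using m(1)[of i] by (simp flip: ennreal_mult'')
  qed
  finally show ?thesis .
qed

section \<open>Strong duality\<close>

text \<open>For the error term: turning a discrete dual pair into a continuous one costs
  \<open>e\<close> on each measure. Returning to the continuous plan costs \<open>e\<close> on each
  measure for the weights and once more \<open>e * measure \<mu> T\<close> for the transport
  cost.\<close>

lemma ET_le_dual_bound:
  fixes T :: "'a::euclidean_space set"
  assumes T: "compact T" "T \<noteq> {}" and b: "0 \<le> b" and lam: "0 \<le> lam"
    and c: "continuous_on (T \<times> T) (\<lambda>z. c (fst z) (snd z))" "\<And>x. x \<in> T \<Longrightarrow> c x x = 0"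
    and w: "\<And>x. x \<in> T \<Longrightarrow> 0 \<le> w1 x" "\<And>x. x \<in> T \<Longrightarrow> 0 \<le> w2 x"
      "w1 \<in> borel_measurable (restrict_space borel T)"
      "w2 \<in> borel_measurable (restrict_space borel T)"
    and \<mu>: "\<mu> \<in> tree_measures T" and \<nu>: "\<nu> \<in> tree_measures T"
    and D: "\<And>u v. (u, v) \<in> dual_set T b c w1 w2 lam \<mu> \<nu> \<Longrightarrow> (\<integral>x. u x \<partial>\<mu>) + (\<integral>y. v y \<partial>\<nu>) \<le> D"
    and e: "0 < e"
  shows "ET T b c w1 w2 lam \<mu> \<nu> \<le> ereal (D + e * (3 * measure \<mu> T + 2 * measure \<nu> T))"
proof -
  note \<mu>' = tree_measuresD[OF \<mu>] and \<nu>' = tree_measuresD[OF \<nu>]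
  interpret \<mu>: finite_measure \<mu> by (rule \<mu>'(1))
  interpret \<nu>: finite_measure \<nu> by (rule \<nu>'(1))
  let ?RT = "restrict_space borel T"
  define q where "q x y = b * (c x y - lam)" for x y
  have q_cont: "continuous_on (T \<times> T) (\<lambda>z. q (fst z) (snd z))"
    unfolding q_def by (intro continuous_intros c)
  have "bounded ((\<lambda>z. q (fst z) (snd z)) ` (T \<times> T))"
    by (intro compact_imp_bounded compact_continuous_image q_cont compact_Times T)
  then obtain M0 where M0: "\<And>x y. x \<in> T \<Longrightarrow> y \<in> T \<Longrightarrow> \<bar>q x y\<bar> \<le> M0"
    by (force simp: bounded_iff)
  have qM0: "0 \<le> q x y + M0" if "x \<in> T" "y \<in> T" for x y
    using M0[OF that] by linarith
  obtain t where t: "t \<in> T" using T(2) by auto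
  have M0_nonneg: "0 \<le> M0" using M0[OF t t] by linarith
  have "uniformly_continuous_on (T \<times> T) (\<lambda>z. q (fst z) (snd z))"
    by (intro compact_uniformly_continuous q_cont compact_Times T)
  then obtain d where d: "0 < d"
    "\<And>z z'. z \<in> T \<times> T \<Longrightarrow> z' \<in> T \<times> T \<Longrightarrow> dist z' z < d \<Longrightarrow> dist (q (fst z') (snd z')) (q (fst z) (snd z)) < e"
    using e unfolding uniformly_continuous_on_def by meson
  have F: "(\<lambda>x. (x, w1 x, w2 x)) \<in> borel_measurable ?RT"
    by (intro borel_measurable_Pair w(3,4)) (rule measurable_restrict_space1, simp)
  \<comment> \<open>Half of \<open>d\<close> per coordinate keeps a pair of points within
    \<open>d\<close> of its pair of representatives.\<close>
  have "0 < min e (d / 2)" using e d(1) by simp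
  from measurable_index_small_fibres[OF F this] obtain I :: "'a \<Rightarrow> nat"
    where I: "I \<in> measurable ?RT (count_space UNIV)"
      and I_close: "\<And>x y. I x = I y \<Longrightarrow> dist (x, w1 x, w2 x) (y, w1 y, w2 y) < min e (d / 2)"
    by blast
  have close: "dist x y < d / 2" "\<bar>w1 x - w1 y\<bar> < e" "\<bar>w2 x - w2 y\<bar> < e" if "I x = I y" for x y
    using I_close[OF that] dist_fst_le[of "(x, w1 x, w2 x)" "(y, w1 y, w2 y)"]
      dist_snd_le[of "(x, w1 x, w2 x)" "(y, w1 y, w2 y)"]
      dist_fst_le[of "(w1 x, w2 x)" "(w1 y, w2 y)"] dist_snd_le[of "(w1 x, w2 x)" "(w1 y, w2 y)"]
    by (auto simp: dist_real_def)
  have I\<mu>[measurable]: "I \<in> measurable \<mu> (count_space UNIV)" and I\<nu>[measurable]: "I \<in> measurable \<nu> (count_space UNIV)"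
    using I by (simp_all add: measurable_cong_sets[OF \<mu>'(3) refl] measurable_cong_sets[OF \<nu>'(3) refl])
  have wm[measurable]: "w1 \<in> borel_measurable \<mu>" "w2 \<in> borel_measurable \<nu>"
    using w(3,4) by (simp_all add: measurable_cong_sets[OF \<mu>'(3) refl] measurable_cong_sets[OF \<nu>'(3) refl])
  \<comment> \<open>Labels without a point in \<open>T\<close> receive \<open>t\<close>, so that
    \<open>rep i\<close> lies in \<open>T\<close> for every index and the discrete weights and costs
    are nonnegative throughout.\<close>
  define rep where "rep i = (if \<exists>x\<in>T. I x = i then SOME x. x \<in> T \<and> I x = i else t)" for i
  have rep: "rep i \<in> T" for i
    unfolding rep_def using t by (auto intro: someI2_ex)
  have I_rep: "I (rep (I x)) = I x" if "x \<in> T" for x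
  proof -
    have "\<exists>x'\<in>T. I x' = I x" using that by auto
    then show ?thesis unfolding rep_def by (auto intro: someI2_ex)
  qed
  have w_rep: "\<bar>w1 x - w1 (rep (I x))\<bar> < e" "\<bar>w2 x - w2 (rep (I x))\<bar> < e" if "x \<in> T" for x
    using close[of x "rep (I x)"] I_rep[OF that] by auto
  have q_rep: "\<bar>q x y - q (rep (I x)) (rep (I y))\<bar> < e" if "x \<in> T" "y \<in> T" for x y
  proof -
    have "dist (x, y) (rep (I x), rep (I y)) \<le> dist x (rep (I x)) + dist y (rep (I y))"
      by (simp add: dist_Pair_Pair sqrt_sum_squares_le_sum)
    also have "\<dots> < d" using close(1)[of x "rep (I x)"] close(1)[of y "rep (I y)"] I_rep that by simp
    finally show ?thesis
      using d(2)[of "(rep (I x), rep (I y))" "(x, y)"] that rep by (simp add: dist_real_def)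
  qed
  define m where "m i = measure \<mu> (I -` {i} \<inter> space \<mu>)" for i
  define k where "k j = measure \<nu> (I -` {j} \<inter> space \<nu>)" for j
  \<comment> \<open>Adding \<open>M0\<close> to the cost and to \<open>w1\<close> changes the objective by the constant \<open>M0 * measure \<mu> T\<close>
    and makes every term nonnegative.\<close>
  define W1 where "W1 i = w1 (rep i) + M0" for i
  define W2 where "W2 j = w2 (rep j)" for j
  define K where "K i j = q (rep i) (rep j) + M0" for i j
  \<comment> \<open>The bound for the discrete dual: \<open>M0\<close> pays for the shift of
    \<open>w1\<close> and of the cost, and the two terms with \<open>e\<close> for passing from
    \<open>u\<close>, \<open>v\<close> to \<open>U\<close>, \<open>V\<close>.\<close>
  define D' where "D' = D + (M0 + e) * measure \<mu> T + e * measure \<nu> T"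
  have mk: "0 \<le> m i" "0 \<le> k i" for i by (auto simp: m_def k_def)
  have sm: "summable m" "summable k"
    unfolding m_def k_def
    by (rule summable_fibre_measure[OF \<mu>'(1) I\<mu>], rule summable_fibre_measure[OF \<nu>'(1) I\<nu>])
  have W: "0 \<le> W1 i" "0 \<le> W2 i" for i
    using w(1,2)[OF rep] M0_nonneg by (auto simp: W1_def W2_def)
  have K0: "0 \<le> K i j" for i j using qM0[OF rep rep] by (simp add: K_def)
  have dual: "(\<Sum>i. u i * m i) + (\<Sum>j. v j * k j) \<le> D'"
    if fin: "finite (range u)" "finite (range v)" and uW: "\<And>i. u i \<le> W1 i" and vW: "\<And>j. v j \<le> W2 j"
      and uv: "\<And>i j. u i + v j \<le> K i j" for u v
  proof -
    \<comment> \<open>Subtracting \<open>M0\<close> undoes the shift; subtracting \<open>e\<close>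
      absorbs the variation of \<open>w1\<close> and of the cost within fibres. \<open>V\<close>
      then lies above \<open>v (I y) - e\<close>, where this \<open>e\<close> absorbs the variation
      of \<open>w2\<close>.\<close>
    define U where "U x = u (I x) - (M0 + e)" for x
    define V where "V y = min (w2 y) (INF x\<in>T. b * (c x y - lam) - U x)" for y
    note fibu = integral_fibres[OF \<mu>'(1) I\<mu> fin(1)] and fibv = integral_fibres[OF \<nu>'(1) I\<nu> fin(2)]
    obtain B where "\<forall>a\<in>range u. norm a \<le> B"
      using finite_imp_bounded[OF fin(1)] unfolding bounded_iff by blast
    then have B: "\<bar>u i\<bar> \<le> B" for i by auto
    have UV: "(U, V) \<in> dual_set T b c w1 w2 lam \<mu> \<nu>"
      unfolding V_def
    proof (rule dual_set_c_transform[OF T b lam c(1) c(2) w(1,2,4) \<mu> \<nu>])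
      show "U \<in> borel_measurable \<mu>" unfolding U_def using fibu(1) by auto
      show "\<bar>U x\<bar> \<le> B + M0 + e" for x
        using B[of "I x"] e M0_nonneg by (auto simp: U_def abs_le_iff)
      show "U x \<le> w1 x" if "x \<in> T" for x
        using uW[of "I x"] w_rep(1)[OF that] by (auto simp: U_def W1_def)
    qed
    have iU: "(\<integral>x. U x \<partial>\<mu>) = (\<Sum>i. u i * m i) - (M0 + e) * measure \<mu> T"
      unfolding U_def using fibu by (simp add: m_def \<mu>')
    have V_ge: "v (I y) - e \<le> V y" if y: "y \<in> T" for y
    proof -
      have "v (I y) - e \<le> w2 y" using vW[of "I y"] w_rep(2)[OF y] by (auto simp: W2_def)
      moreover have "v (I y) - e \<le> (INF x\<in>T. b * (c x y - lam) - U x)"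
      proof (rule cINF_greatest[OF T(2)])
        fix x assume x: "x \<in> T"
        show "v (I y) - e \<le> b * (c x y - lam) - U x"
          using uv[of "I x" "I y"] q_rep[OF x y] e by (auto simp: U_def K_def q_def)
      qed
      ultimately show ?thesis by (simp add: V_def)
    qed
    have "(\<integral>y. v (I y) - e \<partial>\<nu>) \<le> (\<integral>y. V y \<partial>\<nu>)"
      using UV fibv(1) V_ge by (intro integral_mono) (auto simp: dual_set_def \<nu>')
    moreover have "(\<integral>y. v (I y) - e \<partial>\<nu>) = (\<Sum>j. v j * k j) - e * measure \<nu> T"
      using fibv by (simp add: k_def \<nu>')
    ultimately show ?thesis using D[OF UV] iU by (simp add: D'_def)
  qed
  obtain g where g0: "\<And>i j. 0 \<le> g i j" "\<And>i. summable (g i)" "\<And>j. summable (\<lambda>i. g i j)"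
    and row: "\<And>i. (\<Sum>j. g i j) \<le> m i" and col: "\<And>j. (\<Sum>i. g i j) \<le> k j"
    and cost: "(\<Sum>i. ennreal (W1 i * (m i - (\<Sum>j. g i j)))) + (\<Sum>j. ennreal (W2 j * (k j - (\<Sum>i. g i j))))
      + (\<Sum>i. \<Sum>j. ennreal (K i j * g i j)) \<le> ennreal D'"
  proof (rule countable_partial_transport_duality[of m k W1 W2 K D', OF mk(1) sm(1) mk(2) sm(2) W K0 dual])
  qed (assumption | rule that)+
  define \<gamma> where "\<gamma> = density (\<mu> \<Otimes>\<^sub>M \<nu>)
    (\<lambda>z. ennreal (g (I (fst z)) (I (snd z)) / (m (I (fst z)) * k (I (snd z)))))"
  define f1 where "f1 x = (\<Sum>j. g (I x) j) / m (I x)" for x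
  define f2 where "f2 y = (\<Sum>i. g i (I y)) / k (I y)" for y
  note plan = fibrewise_plan[OF \<mu>'(1) I\<mu> \<nu>'(1) I\<nu> g0 row[unfolded m_def] col[unfolded k_def],
      folded m_def k_def, folded \<gamma>_def f1_def f2_def]
  have f_meas[measurable]: "f1 \<in> borel_measurable \<mu>" "f2 \<in> borel_measurable \<nu>"
    unfolding f1_def f2_def
    by (rule measurable_compose[OF I\<mu>], simp, rule measurable_compose[OF I\<nu>], simp)
  have frac: "0 \<le> a / r" "a / r \<le> 1" if "0 \<le> a" "a \<le> r" for a r :: real
    using that by (auto simp: divide_le_eq_1)
  have f01: "0 \<le> f1 x" "f1 x \<le> 1" "0 \<le> f2 x" "f2 x \<le> 1" for x
    unfolding f1_def f2_def
    by (intro frac suminf_nonneg g0 row col)+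
  have s\<gamma>: "sets \<gamma> = sets (restrict_space borel (T \<times> T))"
    unfolding \<gamma>_def sets_density sets_restrict_space_Times
    by (rule sets_pair_measure_cong[OF \<mu>'(3) \<nu>'(3)])
  have sp: "space \<gamma> = T \<times> T"
    using sets_eq_imp_space_eq[OF s\<gamma>] by (simp add: space_restrict_space)
  have proj: "fst \<in> measurable \<gamma> ?RT" "snd \<in> measurable \<gamma> ?RT"
    unfolding measurable_cong_sets[OF s\<gamma> refl]
    by (auto intro!: measurable_restrict_space3 borel_measurable_continuous_onI continuous_intros)
  have m1: "distr \<gamma> ?RT fst = density \<mu> (\<lambda>x. ennreal (f1 x))"
  proof (rule measure_eqI)
    fix A assume "A \<in> sets (distr \<gamma> ?RT fst)"
    then have A: "A \<in> sets \<mu>" by (simp add: \<mu>')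
    then have "fst -` A \<inter> space \<gamma> = A \<times> space \<nu>"
      using sets.sets_into_space[OF A] by (auto simp: sp \<mu>' \<nu>')
    then show "emeasure (distr \<gamma> ?RT fst) A = emeasure (density \<mu> (\<lambda>x. ennreal (f1 x))) A"
      using A plan(1)[OF A] proj(1) by (simp add: emeasure_distr emeasure_density \<mu>')
  qed (simp add: \<mu>')
  have m2: "distr \<gamma> ?RT snd = density \<nu> (\<lambda>y. ennreal (f2 y))"
  proof (rule measure_eqI)
    fix A assume "A \<in> sets (distr \<gamma> ?RT snd)"
    then have A: "A \<in> sets \<nu>" by (simp add: \<nu>')
    then have "snd -` A \<inter> space \<gamma> = space \<mu> \<times> A"
      using sets.sets_into_space[OF A] by (auto simp: sp \<mu>' \<nu>')
    then show "emeasure (distr \<gamma> ?RT snd) A = emeasure (density \<nu> (\<lambda>x. ennreal (f2 x))) A"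
      using A plan(2)[OF A] proj(2) by (simp add: emeasure_distr emeasure_density \<nu>')
  qed (simp add: \<nu>')
  have density_le: "emeasure (density M (\<lambda>x. ennreal (f x))) A \<le> emeasure M A"
    if "A \<in> sets M" "f \<in> borel_measurable M" "\<And>x. f x \<le> 1" for M :: "'a measure" and f A
  proof -
    have "emeasure (density M (\<lambda>x. ennreal (f x))) A = (\<integral>\<^sup>+x. ennreal (f x) * indicator A x \<partial>M)"
      using that by (simp add: emeasure_density)
    also have "\<dots> \<le> (\<integral>\<^sup>+x. indicator A x \<partial>M)"
      using that(3) by (intro nn_integral_mono) (auto split: split_indicator)
    finally show ?thesis using that by simp
  qed
  have \<gamma>_mass: "emeasure \<gamma> (T \<times> T) = ennreal (\<integral>x. f1 x \<partial>\<mu>)"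
  proof -
    have "emeasure \<gamma> (T \<times> T) = (\<integral>\<^sup>+x\<in>T. ennreal (f1 x) \<partial>\<mu>)"
      using plan(1)[of T] sets.top[of \<mu>] by (simp add: \<mu>' \<nu>')
    also have "\<dots> = (\<integral>\<^sup>+x. ennreal (f1 x) \<partial>\<mu>)"
      by (intro nn_integral_cong) (simp add: \<mu>')
    also have "\<dots> = ennreal (\<integral>x. f1 x \<partial>\<mu>)"
      using f01 by (intro nn_integral_eq_integral \<mu>.integrable_const_bound[of _ 1]) auto
    finally show ?thesis .
  qed
  have int_f1: "integrable \<mu> f1" by (rule \<mu>.integrable_const_bound[of _ 1]) (use f01 in auto)
  interpret \<gamma>: finite_measure \<gamma> by (rule finite_measureI) (simp add: sp \<gamma>_mass)
  have \<gamma>_mass': "measure \<gamma> (T \<times> T) = (\<integral>x. f1 x \<partial>\<mu>)"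
    using \<gamma>_mass f01 by (simp add: measure_def integral_nonneg_AE)
  have "(\<integral>x. f1 x \<partial>\<mu>) \<le> (\<integral>x. 1 \<partial>\<mu>)" using int_f1 f01 by (intro integral_mono) auto
  then have mass_le: "measure \<gamma> (T \<times> T) \<le> measure \<mu> T" by (simp add: \<gamma>_mass' \<mu>')
  have in_plans: "(\<gamma>, f1, f2) \<in> partial_plans T \<mu> \<nu>"
    unfolding partial_plans_def using s\<gamma> \<gamma>_mass f_meas f01 m1 m2 density_le
    by auto
  have w1_le: "(\<integral>\<^sup>+x. ennreal ((w1 x + M0) * (1 - f1 x)) \<partial>\<mu>)
      \<le> (\<Sum>i. ennreal (W1 i * (m i - (\<Sum>j. g i j)))) + ennreal (e * measure \<mu> T)"
    unfolding f1_def m_def \<mu>'(2)[symmetric]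
  proof (rule nn_integral_defect_le[OF \<mu>'(1) I\<mu>])
    show "w1 x + M0 \<le> W1 (I x) + e" if "x \<in> space \<mu>" for x
      using w_rep(1)[of x] that by (auto simp: W1_def \<mu>')
  qed (use W e in \<open>auto intro!: suminf_nonneg g0 row[unfolded m_def]\<close>)
  have w2_le: "(\<integral>\<^sup>+y. ennreal (w2 y * (1 - f2 y)) \<partial>\<nu>)
      \<le> (\<Sum>j. ennreal (W2 j * (k j - (\<Sum>i. g i j)))) + ennreal (e * measure \<nu> T)"
    unfolding f2_def k_def \<nu>'(2)[symmetric]
  proof (rule nn_integral_defect_le[OF \<nu>'(1) I\<nu>])
    show "w2 x \<le> W2 (I x) + e" if "x \<in> space \<nu>" for x
      using w_rep(2)[of x] that by (auto simp: W2_def \<nu>')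
  qed (use W e in \<open>auto intro!: suminf_nonneg g0 col[unfolded k_def]\<close>)
  have q_meas: "(\<lambda>z. q (fst z) (snd z)) \<in> borel_measurable \<gamma>"
    unfolding measurable_cong_sets[OF s\<gamma> refl] by (rule borel_measurable_continuous_on_restrict[OF q_cont])
  have q_int: "integrable \<gamma> (\<lambda>z. q (fst z) (snd z))"
    by (rule \<gamma>.integrable_const_bound[OF _ q_meas, of M0]) (use M0 in \<open>auto simp: sp\<close>)
  have K_meas: "(\<lambda>z. ennreal (K (I (fst z)) (I (snd z)))) \<in> borel_measurable \<gamma>"
  proof -
    note proj[measurable] I[measurable]
    have "(\<lambda>z. (\<lambda>i z. ennreal (K i (I (snd z)))) (I (fst z)) z) \<in> borel_measurable \<gamma>"
      by (rule measurable_compose_countable) measurable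
    then show ?thesis by simp
  qed
  have q_le: "(\<integral>\<^sup>+z. ennreal (q (fst z) (snd z) + M0) \<partial>\<gamma>)
      \<le> (\<Sum>i. \<Sum>j. ennreal (K i j * g i j)) + ennreal (e * measure \<mu> T)"
  proof -
    have "(\<integral>\<^sup>+z. ennreal (q (fst z) (snd z) + M0) \<partial>\<gamma>)
        \<le> (\<integral>\<^sup>+z. ennreal (K (I (fst z)) (I (snd z))) + ennreal e \<partial>\<gamma>)"
    proof (rule nn_integral_mono)
      fix z assume "z \<in> space \<gamma>"
      then have "q (fst z) (snd z) + M0 \<le> K (I (fst z)) (I (snd z)) + e"
        using q_rep[of "fst z" "snd z"] by (auto simp: sp K_def)
      then show "ennreal (q (fst z) (snd z) + M0) \<le> ennreal (K (I (fst z)) (I (snd z))) + ennreal e"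
        using e K0 by (simp add: ennreal_leI flip: ennreal_plus)
    qed
    also have "\<dots> = (\<Sum>i. \<Sum>j. ennreal (K i j * g i j)) + ennreal (e * measure \<gamma> (T \<times> T))"
      using e K_meas plan(3)[of K, OF K0]
      by (subst nn_integral_add) (auto simp: sp \<gamma>.emeasure_eq_measure ennreal_mult)
    also have "\<dots> \<le> (\<Sum>i. \<Sum>j. ennreal (K i j * g i j)) + ennreal (e * measure \<mu> T)"
      using mass_le e by (intro add_left_mono ennreal_leI mult_left_mono) auto
    finally show ?thesis .
  qed
  define A where "A = (\<integral>\<^sup>+x. ennreal (w1 x * (1 - f1 x)) \<partial>\<mu>)"
  define B where "B = (\<integral>\<^sup>+y. ennreal (w2 y * (1 - f2 y)) \<partial>\<nu>)"
  define C where "C = (\<integral>z. q (fst z) (snd z) \<partial>\<gamma>)"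
  let ?\<mu> = "measure \<mu> T" and ?\<nu> = "measure \<nu> T" and ?\<gamma> = "measure \<gamma> (T \<times> T)"
  \<comment> \<open>The mass left behind pays \<open>M0 * (?\<mu> - ?\<gamma>)\<close> for the shift
    and the transported mass pays \<open>M0 * ?\<gamma>\<close>; together they cancel the
    \<open>M0\<close> term of \<open>D'\<close>.\<close>
  have A_eq: "(\<integral>\<^sup>+x. ennreal ((w1 x + M0) * (1 - f1 x)) \<partial>\<mu>) = A + ennreal (M0 * (?\<mu> - ?\<gamma>))"
  proof -
    have "(\<integral>\<^sup>+x. ennreal ((w1 x + M0) * (1 - f1 x)) \<partial>\<mu>)
        = (\<integral>\<^sup>+x. ennreal (w1 x * (1 - f1 x)) + ennreal (M0 * (1 - f1 x)) \<partial>\<mu>)"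
      using f01 w(1) M0_nonneg by (intro nn_integral_cong) (simp add: \<mu>' distrib_right)
    also have "\<dots> = A + (\<integral>\<^sup>+x. ennreal (M0 * (1 - f1 x)) \<partial>\<mu>)"
      unfolding A_def by (rule nn_integral_add) auto
    also have "(\<integral>\<^sup>+x. ennreal (M0 * (1 - f1 x)) \<partial>\<mu>) = ennreal (\<integral>x. M0 * (1 - f1 x) \<partial>\<mu>)"
      using f01 M0_nonneg int_f1 by (intro nn_integral_eq_integral) auto
    also have "(\<integral>x. M0 * (1 - f1 x) \<partial>\<mu>) = M0 * (?\<mu> - ?\<gamma>)"
      using int_f1 by (simp add: \<gamma>_mass' \<mu>')
    finally show ?thesis .
  qed
  have C_eq: "(\<integral>\<^sup>+z. ennreal (q (fst z) (snd z) + M0) \<partial>\<gamma>) = ennreal (C + M0 * ?\<gamma>)"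
  proof -
    have "(\<integral>\<^sup>+z. ennreal (q (fst z) (snd z) + M0) \<partial>\<gamma>) = ennreal (\<integral>z. q (fst z) (snd z) + M0 \<partial>\<gamma>)"
      using q_int qM0 by (intro nn_integral_eq_integral AE_I2) (auto simp: sp)
    then show ?thesis using q_int by (simp add: C_def sp mult.commute)
  qed
  have C0: "0 \<le> C + M0 * ?\<gamma>"
  proof -
    have "0 \<le> (\<integral>z. q (fst z) (snd z) + M0 \<partial>\<gamma>)"
      using qM0 by (intro integral_nonneg_AE AE_I2) (auto simp: sp)
    then show ?thesis using q_int by (simp add: C_def sp mult.commute)
  qed
  have D'0: "0 \<le> D'" using dual[of "\<lambda>_. 0" "\<lambda>_. 0"] W K0 by simp
  have "A + ennreal (M0 * (?\<mu> - ?\<gamma>)) + B + ennreal (C + M0 * ?\<gamma>)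
      \<le> (\<Sum>i. ennreal (W1 i * (m i - (\<Sum>j. g i j)))) + ennreal (e * ?\<mu>)
        + ((\<Sum>j. ennreal (W2 j * (k j - (\<Sum>i. g i j)))) + ennreal (e * ?\<nu>))
        + ((\<Sum>i. \<Sum>j. ennreal (K i j * g i j)) + ennreal (e * ?\<mu>))"
    by (rule add_mono[OF add_mono[OF w1_le[unfolded A_eq] w2_le[folded B_def]] q_le[unfolded C_eq]])
  also have "\<dots> = ((\<Sum>i. ennreal (W1 i * (m i - (\<Sum>j. g i j)))) + (\<Sum>j. ennreal (W2 j * (k j - (\<Sum>i. g i j))))
      + (\<Sum>i. \<Sum>j. ennreal (K i j * g i j))) + ennreal (e * (2 * ?\<mu> + ?\<nu>))"
  proof -
    have "ennreal (e * (2 * ?\<mu> + ?\<nu>)) = ennreal (e * ?\<mu>) + ennreal (e * ?\<nu>) + ennreal (e * ?\<mu>)"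
      using e by (simp add: algebra_simps flip: ennreal_plus)
    then show ?thesis by (simp only: add.assoc add.commute add.left_commute)
  qed
  also have "\<dots> \<le> ennreal D' + ennreal (e * (2 * ?\<mu> + ?\<nu>))"
    by (rule add_right_mono[OF cost])
  also have "\<dots> = ennreal (D' + e * (2 * ?\<mu> + ?\<nu>))"
    using D'0 e by simp
  finally have total: "A + ennreal (M0 * (?\<mu> - ?\<gamma>)) + B + ennreal (C + M0 * ?\<gamma>)
      \<le> ennreal (D' + e * (2 * ?\<mu> + ?\<nu>))" .
  \<comment> \<open>The finite right-hand side forces both weight terms of this plan to be finite,
    and the rest is real arithmetic.\<close>
  then have "A \<noteq> top" "B \<noteq> top" by (auto simp: top_unique)
  then obtain a a' where a: "A = ennreal a" "0 \<le> a" "B = ennreal a'" "0 \<le> a'"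
    by (metis ennreal_cases)
  have "a + M0 * (?\<mu> - ?\<gamma>) + a' + (C + M0 * ?\<gamma>) \<le> D' + e * (2 * ?\<mu> + ?\<nu>)"
    using total a C0 M0_nonneg mass_le D'0 e
    by (simp add: ennreal_le_iff flip: ennreal_plus)
  then have "a + a' + C \<le> D + e * (3 * ?\<mu> + 2 * ?\<nu>)"
    by (simp add: D'_def algebra_simps)
  moreover have "C = b * (\<integral>z. c (fst z) (snd z) - lam \<partial>\<gamma>)"
    by (simp add: C_def q_def)
  ultimately have "ET_objective b c w1 w2 lam \<mu> \<nu> (\<gamma>, f1, f2) \<le> ereal (D + e * (3 * ?\<mu> + 2 * ?\<nu>))"
    using a by (simp add: ET_objective_def flip: A_def B_def)
  then show ?thesis unfolding ET_def by (rule INF_lower2[OF in_plans])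
qed

section \<open>Closing the duality gap\<close>

theorem theorem3p4:
  fixes T :: "'a::euclidean_space set"
    and b lam :: real
    and c :: "'a \<Rightarrow> 'a \<Rightarrow> real"
    and w1 w2 :: "'a \<Rightarrow> real"
    and \<mu> \<nu> :: "'a measure"
  assumes "finite_tree T"
    and "b \<ge> 0"
    and "continuous_on (T \<times> T) (\<lambda>z. c (fst z) (snd z))"
    and "\<forall>x\<in>T. c x x = 0"
    and "\<forall>x\<in>T. w1 x \<ge> 0" and "\<forall>x\<in>T. w2 x \<ge> 0"
    and "w1 \<in> borel_measurable (restrict_space borel T)"
    and "w2 \<in> borel_measurable (restrict_space borel T)"
    and "lam \<ge> 0"
    and "\<mu> \<in> tree_measures T" and "\<nu> \<in> tree_measures T"
  shows "ET T b c w1 w2 lam \<mu> \<nu> =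
    (SUP uv \<in> dual_set T b c w1 w2 lam \<mu> \<nu>.
       ereal ((\<integral> x. fst uv x \<partial>\<mu>) + (\<integral> y. snd uv y \<partial>\<nu>)))"
    (is "_ = ?S")
proof (rule antisym)
  note T = finite_treeD[OF assms(1)]
  show "?S \<le> ET T b c w1 w2 lam \<mu> \<nu>"
    unfolding ET_def
  proof (intro SUP_least INF_greatest)
    fix uv p assume "uv \<in> dual_set T b c w1 w2 lam \<mu> \<nu>" "p \<in> partial_plans T \<mu> \<nu>"
    then show "ereal ((\<integral> x. fst uv x \<partial>\<mu>) + (\<integral> y. snd uv y \<partial>\<nu>)) \<le> ET_objective b c w1 w2 lam \<mu> \<nu> p"
      using ET_objective_ge_dual[OF T(1) assms(2,3,10,11), of "fst p" "fst (snd p)" "snd (snd p)"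
          "fst uv" "snd uv"] by simp
  qed
  \<comment> \<open>The zero function with its capped c-transform shows that the dual set is
    nonempty. Hence the supremum is not \<open>-\<infinity>\<close>, and only a finite supremum
    needs an argument.\<close>
  have "(\<lambda>_. 0, \<lambda>y. min (w2 y) (INF x\<in>T. b * (c x y - lam) - 0)) \<in> dual_set T b c w1 w2 lam \<mu> \<nu>"
    using assms T by (intro dual_set_c_transform[where B = 0]) auto
  from SUP_upper[OF this, of "\<lambda>uv. ereal ((\<integral> x. fst uv x \<partial>\<mu>) + (\<integral> y. snd uv y \<partial>\<nu>))"]
  have "?S \<noteq> -\<infinity>" by auto
  show "ET T b c w1 w2 lam \<mu> \<nu> \<le> ?S"
  proof (cases ?S)
    case (real D)
    define R where "R = 3 * measure \<mu> T + 2 * measure \<nu> T"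
    have R: "0 \<le> R" by (simp add: R_def)
    have "(\<integral>x. u x \<partial>\<mu>) + (\<integral>y. v y \<partial>\<nu>) \<le> D" if "(u, v) \<in> dual_set T b c w1 w2 lam \<mu> \<nu>" for u v
      using SUP_upper[OF that, of "\<lambda>uv. ereal ((\<integral> x. fst uv x \<partial>\<mu>) + (\<integral> y. snd uv y \<partial>\<nu>))"] real
      by simp
    then have bound: "ET T b c w1 w2 lam \<mu> \<nu> \<le> ereal (D + e * R)" if "0 < e" for e
      unfolding R_def using assms T that by (intro ET_le_dual_bound) auto
    show ?thesis unfolding real
    proof (rule ereal_le_epsilon2)
      fix e :: real assume e: "0 < e"
      \<comment> \<open>Dividing by \<open>R + 1\<close> instead of \<open>R\<close> covers the case
        of zero total mass.\<close>
      have "e / (R + 1) * R \<le> e" using R e by (simp add: divide_le_eq)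
      then have "ereal (D + e / (R + 1) * R) \<le> ereal D + ereal e" by simp
      with bound[of "e / (R + 1)"] R e show "ET T b c w1 w2 lam \<mu> \<nu> \<le> ereal D + ereal e"
        by (meson add_nonneg_pos divide_pos_pos order_trans zero_less_one)
    qed
  qed (use \<open>?S \<noteq> -\<infinity>\<close> in simp_all)
qed

end
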